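(* Let $r\ge 2$ and $L\ge 2$ be integers, let $G_1,\dots,G_r$ be finite groups with $|G_1|=\dots=|G_r|=L$, let $\mathcal A=G_1*\cdots*G_r$, and let $\mathcal X=\mathrm{Cay}(\mathcal A,S)$ with $S=\bigsqcup_{i=1}^r(G_i\setminus\{e\})$. Put $q:=L-1$ and $s:=r-1$. Then the heat kernel function $k_t^{\mathcal X}\colon\mathcal A\to\mathbb R$ ($t\ge0$) of $\mathcal X$ is given by $k_t^{\mathcal X}(g)=K_t^{\mathcal X}(|g|)$ for all $g\in\mathcal A$, where, for $n\in\mathbb Z_{\ge0}$, $$ K_t^{\mathcal X}(n)=\frac{\max(0,q-s)}{(q+1)(-q)^n}\,e^{-t\frac{q+1}{q}} +\frac{2s}{\pi\sqrt{qs}^{\,n}}\int_0^\pi\frac{e^{-t\frac{1+qs-2\sqrt{qs}\cos x}{q(s+1)}}\Bigl(s\sin((n+1)x)+(q-1)\sqrt{\tfrac{s}{q}}\,\sin nx-\sin((n-1)x)\Bigr)\sin x}{\bigl((q-1)\sqrt{\tfrac{s}{q}}+(s-1)\cos x\bigr)^2+\bigl((s+1)\sin x\bigr)^2}\,\mathrm dx . $$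
   Context: For $g\in\mathcal A=G_1*\cdots*G_r$, $|g|$ denotes the length of the reduced word representing $g$ (number of syllables, i.e. of non-identity letters from the factors, consecutive letters lying in different factors), with $|e|=0$. The normalized Laplacian of the Cayley graph $\mathcal X$ is the bounded self-adjoint operator on $\ell^2(\mathcal A)$ $$(\mathcal L_{\mathcal X}f)(x)=f(x)-\frac1{|S|}\sum_{a\in S}f(xa),\quad x\in\mathcal A .$$ The heat operator is $h_t^{\mathcal X}=e^{-t\mathcal L_{\mathcal X}}$, $t\ge0$. By invariance under left translations, there is a function $k_t^{\mathcal X}\colon\mathcal A\to\mathbb R$, the heat kernel function, determined by $$(h_t^{\mathcal X}f)(x)=\sum_{y\in\mathcal A}k_t^{\mathcal X}(y^{-1}x)f(y),\quad f\in\ell^2(\mathcal A).$$ *)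

theory Defs
  imports "HOL-Analysis.Analysis" "HOL-Algebra.Group"
begin

section \<open>Free products of groups\<close>

text \<open>
  A word over the disjoint union of the groups \<open>G i\<close> is a list of letters \<open>(i, a)\<close>, where the
  tag \<open>i\<close> records the factor to which \<open>a\<close> belongs.
\<close>

definition reduced_words :: "'i set \<Rightarrow> ('i \<Rightarrow> ('a, 'c) monoid_scheme) \<Rightarrow> ('i \<times> 'a) list set" where
  "reduced_words I G =
     {w. (\<forall>(i, a) \<in> set w. i \<in> I \<and> a \<in> carrier (G i) - {\<one>\<^bsub>G i\<^esub>}) \<and>
         successively (\<lambda>u v. fst u \<noteq> fst v) w}"

text \<open>Left multiplication of a reduced word by one letter, which may be an identity element.\<close>

fun letter_mult :: "('i \<Rightarrow> ('a, 'c) monoid_scheme) \<Rightarrow> 'i \<times> 'a \<Rightarrow> ('i \<times> 'a) list \<Rightarrow> ('i \<times> 'a) list" where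
  "letter_mult G (i, a) [] = (if a = \<one>\<^bsub>G i\<^esub> then [] else [(i, a)])"
| "letter_mult G (i, a) ((j, b) # w) =
     (if a = \<one>\<^bsub>G i\<^esub> then (j, b) # w
      else if i = j then
        (if a \<otimes>\<^bsub>G i\<^esub> b = \<one>\<^bsub>G i\<^esub> then w else (i, a \<otimes>\<^bsub>G i\<^esub> b) # w)
      else (i, a) # (j, b) # w)"

definition free_product :: "'i set \<Rightarrow> ('i \<Rightarrow> ('a, 'c) monoid_scheme) \<Rightarrow> ('i \<times> 'a) list monoid" where
  "free_product I G =
     \<lparr>carrier = reduced_words I G, mult = (\<lambda>u v. foldr (letter_mult G) u v), one = []\<rparr>"

definition factor_generators :: "'i set \<Rightarrow> ('i \<Rightarrow> ('a, 'c) monoid_scheme) \<Rightarrow> ('i \<times> 'a) list set" where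
  "factor_generators I G = {[(i, a)] | i a. i \<in> I \<and> a \<in> carrier (G i) - {\<one>\<^bsub>G i\<^esub>}}"

lemma reduced_words_Nil [simp]: "[] \<in> reduced_words I G"
  by (simp add: reduced_words_def)

lemma reduced_words_Cons:
  "(i, a) # w \<in> reduced_words I G \<longleftrightarrow>
     i \<in> I \<and> a \<in> carrier (G i) \<and> a \<noteq> \<one>\<^bsub>G i\<^esub> \<and> w \<in> reduced_words I G \<and>
     (w = [] \<or> fst (hd w) \<noteq> i)"
  by (cases w) (auto simp: reduced_words_def)

lemma letter_mult_reduced:
  assumes "\<And>i. i \<in> I \<Longrightarrow> group (G i)" "i \<in> I" "a \<in> carrier (G i)" "w \<in> reduced_words I G"
  shows "letter_mult G (i, a) w \<in> reduced_words I G"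
proof -
  interpret group "G i" using assms by simp
  show ?thesis
    using assms by (cases "(G, (i, a), w)" rule: letter_mult.cases) (auto simp: reduced_words_Cons)
qed

lemma letter_mult_one [simp]: "letter_mult G (i, \<one>\<^bsub>G i\<^esub>) w = w"
  by (cases "(G, (i, \<one>\<^bsub>G i\<^esub>), w)" rule: letter_mult.cases) auto

lemma letter_mult_Cons_reduced:
  "(i, a) # w \<in> reduced_words I G \<Longrightarrow> letter_mult G (i, a) w = (i, a) # w"
  by (cases "(G, (i, a), w)" rule: letter_mult.cases) (auto simp: reduced_words_Cons)

lemma letter_mult_mult:
  assumes "\<And>i. i \<in> I \<Longrightarrow> group (G i)" "i \<in> I" "a \<in> carrier (G i)" "b \<in> carrier (G i)"
    "w \<in> reduced_words I G"
  shows "letter_mult G (i, a) (letter_mult G (i, b) w) = letter_mult G (i, a \<otimes>\<^bsub>G i\<^esub> b) w"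
proof -
  interpret group "G i" using assms by simp
  show ?thesis
  proof (cases w)
    case Nil
    then show ?thesis using assms by auto
  next
    case (Cons l v)
    obtain j c where l: "l = (j, c)" by (cases l)
    have c: "j \<in> I" "c \<in> carrier (G j)" "c \<noteq> \<one>\<^bsub>G j\<^esub>" "v \<in> reduced_words I G"
      "v = [] \<or> fst (hd v) \<noteq> j"
      using assms(5) unfolding Cons l by (auto simp: reduced_words_Cons)
    show ?thesis
    proof (cases "j = i")
      case False
      then show ?thesis using assms c unfolding Cons l by auto
    next
      case True
      have cc: "c \<in> carrier (G i)" "c \<noteq> \<one>\<^bsub>G i\<^esub>" using c True by auto
      have as: "a \<otimes>\<^bsub>G i\<^esub> b \<otimes>\<^bsub>G i\<^esub> c = a \<otimes>\<^bsub>G i\<^esub> (b \<otimes>\<^bsub>G i\<^esub> c)"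
        using assms cc by (simp add: m_assoc)
      have v: "letter_mult G (i, x) v = (if x = \<one>\<^bsub>G i\<^esub> then v else (i, x) # v)" for x
        using c(5) True by (cases "(G, (i, x), v)" rule: letter_mult.cases) auto
      have gen: "letter_mult G (i, x) ((i, c) # v) =
          (if x \<otimes>\<^bsub>G i\<^esub> c = \<one>\<^bsub>G i\<^esub> then v else (i, x \<otimes>\<^bsub>G i\<^esub> c) # v)" if "x \<in> carrier (G i)" for x
        using that cc by auto
      have gen': "letter_mult G (i, x) ((i, d) # v) =
          (if x \<otimes>\<^bsub>G i\<^esub> d = \<one>\<^bsub>G i\<^esub> then v else (i, x \<otimes>\<^bsub>G i\<^esub> d) # v)"
        if "x \<in> carrier (G i)" "d \<in> carrier (G i)" "d \<noteq> \<one>\<^bsub>G i\<^esub>" for x d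
        using that by auto
      show ?thesis unfolding Cons l True
        using assms(3,4) cc v as by (simp add: gen gen' del: letter_mult.simps)
    qed
  qed
qed

lemma free_product_group:
  assumes G: "\<And>i. i \<in> I \<Longrightarrow> group (G i)"
  shows "group (free_product I G)"
proof -
  let ?R = "reduced_words I G" and ?m = "\<lambda>u v. foldr (letter_mult G) u v"
  have closed: "?m u v \<in> ?R" if "u \<in> ?R" "v \<in> ?R" for u v
    using that(1)
  proof (induction u)
    case Nil
    then show ?case using that by simp
  next
    case (Cons l u)
    then show ?case using letter_mult_reduced[OF G] by (cases l) (auto simp: reduced_words_Cons)
  qed
  have step: "?m (letter_mult G (i, a) u) v = letter_mult G (i, a) (?m u v)"
    if "i \<in> I" "a \<in> carrier (G i)" "u \<in> ?R" "v \<in> ?R" for i a u v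
  proof (cases u)
    case Nil
    then show ?thesis by simp
  next
    case (Cons l w)
    obtain j b where l: "l = (j, b)" by (cases l)
    have w: "j \<in> I" "b \<in> carrier (G j)" "b \<noteq> \<one>\<^bsub>G j\<^esub>" "w \<in> ?R"
      using that(3) unfolding Cons l by (auto simp: reduced_words_Cons)
    have "letter_mult G (i, a) (letter_mult G (i, b) (?m w v)) =
        letter_mult G (i, a \<otimes>\<^bsub>G i\<^esub> b) (?m w v)" if "i = j"
      by (rule letter_mult_mult[OF G]) (use \<open>i \<in> I\<close> \<open>a \<in> carrier (G i)\<close> w closed[OF w(4) \<open>v \<in> ?R\<close>] that in auto)
    then show ?thesis unfolding Cons l by auto
  qed
  have assoc: "?m (?m u v) w = ?m u (?m v w)" if "u \<in> ?R" "v \<in> ?R" "w \<in> ?R" for u v w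
    using that(1)
  proof (induction u)
    case Nil
    then show ?case by simp
  next
    case (Cons l u)
    obtain i a where l: "l = (i, a)" by (cases l)
    from Cons show ?case
      using step[of i a "?m u v" w] closed that unfolding l by (auto simp: reduced_words_Cons)
  qed
  have inverse: "\<exists>y\<in>?R. ?m y x = []" if "x \<in> ?R" for x
    using that
  proof (induction x)
    case Nil
    then show ?case by (intro bexI[of _ "[]"]) auto
  next
    case (Cons l x)
    obtain i a where l: "l = (i, a)" by (cases l)
    have a: "i \<in> I" "a \<in> carrier (G i)" "a \<noteq> \<one>\<^bsub>G i\<^esub>" "x \<in> ?R"
      using Cons.prems unfolding l by (auto simp: reduced_words_Cons)
    interpret group "G i" using G a by simp
    obtain y where y: "y \<in> ?R" "?m y x = []" using Cons.IH a by blast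
    let ?b = "[(i, inv\<^bsub>G i\<^esub> a)]"
    have b: "?b \<in> ?R" using a by (auto simp: reduced_words_Cons)
    have "?m ?b (l # x) = letter_mult G (i, inv\<^bsub>G i\<^esub> a) (letter_mult G (i, a) x)"
      using letter_mult_Cons_reduced[of i a x I G] Cons.prems unfolding l by simp
    also have "\<dots> = x"
      using letter_mult_mult[of I G i "inv\<^bsub>G i\<^esub> a" a x] G a by simp
    finally have "?m (?m y ?b) (l # x) = []"
      using assoc[OF y(1) b Cons.prems] y(2) by simp
    then show ?case using closed[OF y(1) b] by blast
  qed
  show ?thesis
    by (rule groupI) (auto simp: free_product_def closed assoc inverse simp del: foldr.simps(2))
qed

section \<open>Operators on the Hilbert space of square-summable functions\<close>

text \<open>
  Operators on \<open>\<ell>\<^sup>2(X)\<close> are represented by maps on all functions; only the values at points of \<open>X\<close>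
  are meaningful.
\<close>

definition ell2 :: "'b set \<Rightarrow> ('b \<Rightarrow> complex) set" where
  "ell2 X = {f. (\<lambda>x. (cmod (f x))\<^sup>2) summable_on X}"

definition ell2_norm :: "'b set \<Rightarrow> ('b \<Rightarrow> complex) \<Rightarrow> real" where
  "ell2_norm X f = sqrt (\<Sum>\<^sub>\<infinity>x\<in>X. (cmod (f x))\<^sup>2)"

text \<open>
  \<open>E\<close> is the exponential of the bounded operator \<open>T\<close> on \<open>\<ell>\<^sup>2(X)\<close>: the exponential series of \<open>T\<close>
  converges to \<open>E\<close> in operator norm.
\<close>

definition is_operator_exp ::
    "'b set \<Rightarrow> (('b \<Rightarrow> complex) \<Rightarrow> 'b \<Rightarrow> complex) \<Rightarrow> (('b \<Rightarrow> complex) \<Rightarrow> 'b \<Rightarrow> complex) \<Rightarrow> bool" where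
  "is_operator_exp X T E \<longleftrightarrow>
     (\<forall>\<epsilon>>0. \<forall>\<^sub>F N in sequentially. \<forall>f\<in>ell2 X.
        (\<lambda>x. (\<Sum>n<N. (T ^^ n) f x / fact n) - E f x) \<in> ell2 X \<and>
        ell2_norm X (\<lambda>x. (\<Sum>n<N. (T ^^ n) f x / fact n) - E f x) \<le> \<epsilon> * ell2_norm X f)"

section \<open>Heat kernels of Cayley graphs\<close>

definition cayley_laplacian ::
    "('b, 'c) monoid_scheme \<Rightarrow> 'b set \<Rightarrow> ('b \<Rightarrow> complex) \<Rightarrow> 'b \<Rightarrow> complex" where
  "cayley_laplacian A S f x = f x - (\<Sum>a\<in>S. f (x \<otimes>\<^bsub>A\<^esub> a)) / of_nat (card S)"

definition is_heat_operator ::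
    "('b, 'c) monoid_scheme \<Rightarrow> 'b set \<Rightarrow> real \<Rightarrow> (('b \<Rightarrow> complex) \<Rightarrow> 'b \<Rightarrow> complex) \<Rightarrow> bool" where
  "is_heat_operator A S t H \<longleftrightarrow>
     is_operator_exp (carrier A) (\<lambda>f x. - of_real t * cayley_laplacian A S f x) H"

definition is_heat_kernel ::
    "('b, 'c) monoid_scheme \<Rightarrow> 'b set \<Rightarrow> (real \<Rightarrow> 'b \<Rightarrow> real) \<Rightarrow> bool" where
  "is_heat_kernel A S k \<longleftrightarrow>
     (\<forall>t\<ge>0. \<exists>H. is_heat_operator A S t H \<and>
        (\<forall>f\<in>ell2 (carrier A). \<forall>x\<in>carrier A.
           ((\<lambda>y. of_real (k t (inv\<^bsub>A\<^esub> y \<otimes>\<^bsub>A\<^esub> x)) * f y) has_sum H f x) (carrier A)))"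

text \<open>
  When \<open>q = s\<close> the denominator of the integrand vanishes at an endpoint of the interval of
  integration; the value of the integrand there is irrelevant.
\<close>

definition heat_K :: "real \<Rightarrow> real \<Rightarrow> real \<Rightarrow> nat \<Rightarrow> real" where
  "heat_K q s t n =
     max 0 (q - s) / ((q + 1) * (- q) ^ n) * exp (- t * ((q + 1) / q))
     + 2 * s / (pi * sqrt (q * s) ^ n) *
       integral {0..pi} (\<lambda>x.
         exp (- t * ((1 + q * s - 2 * sqrt (q * s) * cos x) / (q * (s + 1)))) *
         (s * sin ((real n + 1) * x) + (q - 1) * sqrt (s / q) * sin (real n * x)
            - sin ((real n - 1) * x)) * sin x
         / (((q - 1) * sqrt (s / q) + (s - 1) * cos x)\<^sup>2 + ((s + 1) * sin x)\<^sup>2))"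

end

theory Submission
  imports Defs
begin

text \<open>
  Let \<open>\<delta>\<close> be the point mass at the identity and \<open>\<Delta>\<close> the Laplacian. Since \<open>\<Delta>\<close> is
  bounded and commutes with left translations, a function \<open>k\<close> is the heat kernel exactly when \<open>k
  t\<close> is pointwise the sum of the exponential series \<open>\<Sum>m. (-t) ^ m \<Delta> ^ m \<delta> / m!\<close>
  (\<open>group.is_heat_kernel_iff\<close>). Everything then reduces to computing the functions \<open>\<Delta> ^ m
  \<delta>\<close>.

  A reduced word of length \<open>n > 0\<close> has \<open>s q\<close> neighbours of length \<open>n + 1\<close>, \<open>q - 1\<close> of length \<open>n\<close>
  and one of length \<open>n - 1\<close>, so on functions of the length \<open>\<Delta>\<close> acts as a three-term
  operator on sequences, \<open>radial_laplacian\<close>. Its eigenvectors are known: the geometric sequence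
  \<open>1 / (-q) ^ n\<close>, with eigenvalue \<open>(q + 1) / q\<close>, and, for \<open>0 < x < \<pi>\<close>, the sequence of the
  numerators in the integral formula divided by \<open>sqrt (q s) ^ n\<close>, with eigenvalue \<open>(1 + q s - 2
  sqrt (q s) cos x) / (q (s + 1))\<close>. Call \<open>K\<^sub>0\<close> the right-hand side of the claimed formula at \<open>t
  = 0\<close>. It is a superposition of these eigenvectors, so the formula holds for all \<open>t\<close> as soon as
  \<open>K\<^sub>0\<close> is the indicator of \<open>n = 0\<close>: multiplying by the eigenvalue under the integral sign gives
  the moments \<open>\<Delta> ^ m \<delta>\<close>, and dominated convergence sums the exponential series.

  To see that \<open>K\<^sub>0\<close> is that indicator, put \<open>z = exp (\<i> x)\<close>, \<open>\<rho> = sqrt (q s)\<close> and \<open>\<sigma> = sqrt (s /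
  q)\<close>. Without its exponential factor, the integrand is, for \<open>0 < x < \<pi>\<close>, equal to \<open>sin x\<close> times
  the imaginary part of \<open>z ^ (n + 1) / ((\<rho> - z) (\<sigma> + z))\<close>. Partial fractions leave integrals of
  \<open>sin x Im (z ^ (n + 1) / (c - z))\<close> for the two poles \<open>c = \<rho>\<close> and \<open>c = -\<sigma>\<close>. They satisfy a
  first-order recursion in \<open>n\<close> and are bounded in \<open>n\<close>, which determines them when \<open>c\<close> is off the
  unit circle. The pole \<open>\<rho> \<ge> 1\<close> is never inside the circle; the pole \<open>-\<sigma>\<close> is inside exactly when
  \<open>q > s\<close>, and its residue is then cancelled by the discrete term of the formula. On the circle,
  which occurs for \<open>q = s\<close>, the factor \<open>sin x\<close> removes the singularity and the integrals are
  elementary.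
\<close>

section \<open>Exponentials of bounded operators on square-summable functions\<close>

text \<open>
  Bounds over finite sets suffice, so that countable sums of functions can be estimated by the
  finite triangle inequality followed by a pointwise limit.
\<close>

lemma ell2_bounded_sums:
  assumes "0 \<le> B" "\<And>F. finite F \<Longrightarrow> F \<subseteq> X \<Longrightarrow> L2_set (\<lambda>x. cmod (f x)) F \<le> B"
  shows "f \<in> ell2 X" "ell2_norm X f \<le> B"
proof -
  have le: "(\<Sum>x\<in>F. (cmod (f x))\<^sup>2) \<le> B\<^sup>2" if "finite F" "F \<subseteq> X" for F
    using assms(2)[OF that] unfolding L2_set_def by (simp add: sqrt_le_D)
  show f: "f \<in> ell2 X"
    unfolding ell2_def using le
    by (auto intro!: nonneg_bdd_above_summable_on bdd_aboveI2[where M = "B\<^sup>2"])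
  show "ell2_norm X f \<le> B"
  proof -
    have "(\<Sum>\<^sub>\<infinity>x\<in>X. (cmod (f x))\<^sup>2) \<le> B\<^sup>2"
      by (rule infsum_le_finite_sums) (use f le in \<open>auto simp: ell2_def\<close>)
    then show ?thesis using assms(1) unfolding ell2_norm_def by (rule real_le_lsqrt[rotated])
  qed
qed

lemma L2_set_le_ell2_norm:
  assumes "f \<in> ell2 X" "finite F" "F \<subseteq> X"
  shows "L2_set (\<lambda>x. cmod (f x)) F \<le> ell2_norm X f"
  unfolding L2_set_def ell2_norm_def
  by (intro real_sqrt_le_mono finite_sum_le_infsum) (use assms in \<open>auto simp: ell2_def\<close>)

lemma ell2_norm_nonneg [simp]: "0 \<le> ell2_norm X f"
  by (simp add: ell2_norm_def infsum_nonneg)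

lemma cmod_le_ell2_norm: "f \<in> ell2 X \<Longrightarrow> x \<in> X \<Longrightarrow> cmod (f x) \<le> ell2_norm X f"
  using L2_set_le_ell2_norm[of f X "{x}"] by simp

lemma L2_set_sum_le:
  "finite A \<Longrightarrow> L2_set (\<lambda>x. cmod (\<Sum>n\<in>A. a n x)) F \<le> (\<Sum>n\<in>A. L2_set (\<lambda>x. cmod (a n x)) F)"
proof (induction A rule: finite_induct)
  case (insert n A)
  have "L2_set (\<lambda>x. cmod (\<Sum>n\<in>insert n A. a n x)) F
      \<le> L2_set (\<lambda>x. cmod (a n x) + cmod (\<Sum>n\<in>A. a n x)) F"
    using insert by (intro L2_set_mono) (auto simp: norm_triangle_ineq)
  also have "\<dots> \<le> L2_set (\<lambda>x. cmod (a n x)) F + L2_set (\<lambda>x. cmod (\<Sum>n\<in>A. a n x)) F"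
    by (rule L2_set_triangle_ineq)
  finally show ?case using insert by simp
qed (simp add: L2_set_def)

definition bounded_on_ell2 :: "'b set \<Rightarrow> (('b \<Rightarrow> complex) \<Rightarrow> 'b \<Rightarrow> complex) \<Rightarrow> real \<Rightarrow> bool" where
  "bounded_on_ell2 X T C \<longleftrightarrow>
     0 \<le> C \<and> (\<forall>f\<in>ell2 X. T f \<in> ell2 X \<and> ell2_norm X (T f) \<le> C * ell2_norm X f)"

lemma bounded_on_ell2_funpow:
  assumes "bounded_on_ell2 X T C" "f \<in> ell2 X"
  shows "(T ^^ n) f \<in> ell2 X \<and> ell2_norm X ((T ^^ n) f) \<le> C ^ n * ell2_norm X f"
proof (induction n)
  case (Suc n)
  then have *: "T ((T ^^ n) f) \<in> ell2 X"
      "ell2_norm X (T ((T ^^ n) f)) \<le> C * ell2_norm X ((T ^^ n) f)" "0 \<le> C"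
    using assms(1) unfolding bounded_on_ell2_def by blast+
  have "C * ell2_norm X ((T ^^ n) f) \<le> C * (C ^ n * ell2_norm X f)"
    using Suc * by (intro mult_left_mono) auto
  then show ?case using * by (simp add: mult.assoc)
qed (use assms in simp)

text \<open>
  The exponential of \<open>T\<close>, built pointwise; this is legitimate because evaluation at a point is
  bounded by the norm.
\<close>

definition exp_series :: "(('b \<Rightarrow> complex) \<Rightarrow> 'b \<Rightarrow> complex) \<Rightarrow> ('b \<Rightarrow> complex) \<Rightarrow> 'b \<Rightarrow> complex" where
  "exp_series T f x = (\<Sum>n. (T ^^ n) f x / fact n)"

lemma exp_series_real_sums: "(\<lambda>n. C ^ n / fact n) sums exp (C::real)"
  using exp_converges[of C] by (simp add: divide_inverse mult.commute)

lemma exp_series_term_le: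
  assumes "bounded_on_ell2 X T C" "f \<in> ell2 X" "x \<in> X"
  shows "cmod ((T ^^ n) f x / fact n) \<le> C ^ n / fact n * ell2_norm X f"
proof -
  have "cmod ((T ^^ n) f x) \<le> C ^ n * ell2_norm X f"
    using bounded_on_ell2_funpow[OF assms(1,2), of n] cmod_le_ell2_norm[of "(T ^^ n) f" X x] assms(3)
    by linarith
  then show ?thesis by (simp add: norm_divide divide_right_mono)
qed

lemma exp_series_summable:
  assumes "bounded_on_ell2 X T C" "f \<in> ell2 X" "x \<in> X"
  shows "summable (\<lambda>n. (T ^^ n) f x / fact n)"
  by (rule summable_comparison_test'[where g = "\<lambda>n. C ^ n / fact n * ell2_norm X f" and N = 0])
     (rule exp_series_term_le[OF assms] summable_mult2 sums_summable[OF exp_series_real_sums])+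

lemma cmod_exp_series_le:
  assumes "bounded_on_ell2 X T C" "f \<in> ell2 X" "x \<in> X"
  shows "cmod (exp_series T f x) \<le> exp C * ell2_norm X f"
proof -
  have s: "(\<lambda>n. C ^ n / fact n * ell2_norm X f) sums (exp C * ell2_norm X f)"
    by (intro sums_mult2 exp_series_real_sums)
  have "cmod (exp_series T f x) \<le> (\<Sum>n. C ^ n / fact n * ell2_norm X f)"
    unfolding exp_series_def
    by (rule norm_suminf_le[OF exp_series_term_le[OF assms] sums_summable[OF s]])
  then show ?thesis using s by (simp add: sums_iff)
qed

text \<open>
  On a finite set the tail is a limit of finite sums of terms, each controlled by \<open>C ^ n / n!\<close>;
  the bound does not depend on the finite set. The estimate is uniform in \<open>f\<close>, which gives convergence in operator norm.
\<close>

lemma exp_series_tail: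
  assumes "bounded_on_ell2 X T C" "f \<in> ell2 X"
  defines "R \<equiv> \<lambda>N. (exp C - (\<Sum>n<N. C ^ n / fact n)) * ell2_norm X f"
  shows "(\<lambda>x. (\<Sum>n<N. (T ^^ n) f x / fact n) - exp_series T f x) \<in> ell2 X"
    and "ell2_norm X (\<lambda>x. (\<Sum>n<N. (T ^^ n) f x / fact n) - exp_series T f x) \<le> R N"
proof -
  let ?a = "\<lambda>n x. (T ^^ n) f x / fact n"
  have C: "0 \<le> C" using assms(1) by (simp add: bounded_on_ell2_def)
  have part: "(\<Sum>n\<in>A. C ^ n / fact n) \<le> exp C" if "finite A" for A
    using sum_le_suminf[OF sums_summable[OF exp_series_real_sums[of C]] that] C
      exp_series_real_sums[of C] by (simp add: sums_iff)
  have R0: "0 \<le> R N" using part[of "{..<N}"] by (simp add: R_def)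
  have "L2_set (\<lambda>x. cmod ((\<Sum>n<N. ?a n x) - exp_series T f x)) F \<le> R N" if F: "finite F" "F \<subseteq> X" for F
  proof (rule LIMSEQ_le_const2)
    show "(\<lambda>M. L2_set (\<lambda>x. cmod ((\<Sum>n<N. ?a n x) - (\<Sum>n<M. ?a n x))) F)
        \<longlonglongrightarrow> L2_set (\<lambda>x. cmod ((\<Sum>n<N. ?a n x) - exp_series T f x)) F"
      unfolding L2_set_def exp_series_def
      using F by (intro tendsto_intros summable_LIMSEQ exp_series_summable[OF assms(1,2)]) auto
    have "L2_set (\<lambda>x. cmod ((\<Sum>n<N. ?a n x) - (\<Sum>n<M. ?a n x))) F \<le> R N" if "M \<ge> N" for M
    proof -
      have split: "{..<M} = {..<N} \<union> {N..<M}" "{..<N} \<inter> {N..<M} = {}" using that by auto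
      have eq: "cmod ((\<Sum>n<N. ?a n x) - (\<Sum>n<M. ?a n x)) = cmod (\<Sum>n=N..<M. ?a n x)" for x
        unfolding split(1) by (subst sum.union_disjoint) (auto simp: norm_minus_commute)
      have le: "L2_set (\<lambda>x. cmod (?a n x)) F \<le> C ^ n / fact n * ell2_norm X f" for n
      proof -
        have "L2_set (\<lambda>x. cmod (?a n x)) F = L2_set (\<lambda>x. cmod ((T ^^ n) f x)) F / fact n"
          using L2_set_right_distrib[of "1 / fact n" "\<lambda>x. cmod ((T ^^ n) f x)" F]
          by (simp add: norm_divide)
        also have "\<dots> \<le> C ^ n * ell2_norm X f / fact n"
          using bounded_on_ell2_funpow[OF assms(1,2), of n] L2_set_le_ell2_norm[OF _ F, of "(T ^^ n) f"]
          by (intro divide_right_mono) auto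
        finally show ?thesis by simp
      qed
      have "L2_set (\<lambda>x. cmod (\<Sum>n=N..<M. ?a n x)) F \<le> (\<Sum>n=N..<M. C ^ n / fact n * ell2_norm X f)"
        by (rule order_trans[OF L2_set_sum_le]) (auto intro!: sum_mono le simp del: times_divide_eq_left)
      also have "\<dots> = ((\<Sum>n<M. C ^ n / fact n) - (\<Sum>n<N. C ^ n / fact n)) * ell2_norm X f"
        unfolding split(1) by (subst sum.union_disjoint) (auto simp: sum_distrib_right)
      also have "\<dots> \<le> R N"
        unfolding R_def using part[of "{..<M}"] by (intro mult_right_mono) auto
      finally show ?thesis unfolding eq .
    qed
    then show "\<exists>M0. \<forall>M\<ge>M0. L2_set (\<lambda>x. cmod ((\<Sum>n<N. ?a n x) - (\<Sum>n<M. ?a n x))) F \<le> R N"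
      by blast
  qed
  from ell2_bounded_sums[OF R0 this]
  show "(\<lambda>x. (\<Sum>n<N. ?a n x) - exp_series T f x) \<in> ell2 X"
    and "ell2_norm X (\<lambda>x. (\<Sum>n<N. ?a n x) - exp_series T f x) \<le> R N"
    by auto
qed

lemma is_operator_exp_exp_series:
  assumes "bounded_on_ell2 X T C"
  shows "is_operator_exp X T (exp_series T)"
  unfolding is_operator_exp_def
proof (intro allI impI)
  fix \<epsilon> :: real assume "\<epsilon> > 0"
  have "(\<lambda>N. \<Sum>n<N. C ^ n / fact n) \<longlonglongrightarrow> exp C"
    using exp_series_real_sums by (simp add: sums_def)
  then have "\<forall>\<^sub>F N in sequentially. (\<Sum>n<N. C ^ n / fact n) > exp C - \<epsilon>"
    using \<open>\<epsilon> > 0\<close> by (intro order_tendstoD) auto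
  then show "\<forall>\<^sub>F N in sequentially. \<forall>f\<in>ell2 X.
      (\<lambda>x. (\<Sum>n<N. (T ^^ n) f x / fact n) - exp_series T f x) \<in> ell2 X \<and>
      ell2_norm X (\<lambda>x. (\<Sum>n<N. (T ^^ n) f x / fact n) - exp_series T f x) \<le> \<epsilon> * ell2_norm X f"
  proof eventually_elim
    case (elim N)
    show ?case
    proof (intro ballI conjI exp_series_tail(1)[OF assms])
      fix f assume f: "f \<in> ell2 X"
      show "ell2_norm X (\<lambda>x. (\<Sum>n<N. (T ^^ n) f x / fact n) - exp_series T f x) \<le> \<epsilon> * ell2_norm X f"
        by (rule order_trans[OF exp_series_tail(2)[OF assms f]])
           (use elim in \<open>auto intro: mult_right_mono\<close>)
    qed
  qed
qed

text \<open>
  Norm convergence implies pointwise convergence, so any operator exponential has the pointwise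
  values of the exponential series; this gives uniqueness of the heat kernel.
\<close>

lemma is_operator_exp_sums:
  assumes "is_operator_exp X T H" "f \<in> ell2 X" "x \<in> X"
  shows "(\<lambda>n. (T ^^ n) f x / fact n) sums H f x"
  unfolding sums_def
proof (rule LIMSEQ_I)
  fix e :: real assume "e > 0"
  \<comment> \<open>The summand 1 avoids division by zero when the norm vanishes.\<close>
  define \<epsilon> where "\<epsilon> = e / (ell2_norm X f + 1)"
  have pos: "ell2_norm X f + 1 > 0" using ell2_norm_nonneg[of X f] by linarith
  then have "\<epsilon> > 0" using \<open>e > 0\<close> by (simp add: \<epsilon>_def)
  have "\<epsilon> * ell2_norm X f < \<epsilon> * (ell2_norm X f + 1)" using \<open>\<epsilon> > 0\<close> by simp
  also have "\<dots> = e" using pos by (simp add: \<epsilon>_def)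
  finally have small: "\<epsilon> * ell2_norm X f < e" .
  obtain N0 where N0: "\<And>N. N \<ge> N0 \<Longrightarrow>
      (\<lambda>x. (\<Sum>n<N. (T ^^ n) f x / fact n) - H f x) \<in> ell2 X \<and>
      ell2_norm X (\<lambda>x. (\<Sum>n<N. (T ^^ n) f x / fact n) - H f x) \<le> \<epsilon> * ell2_norm X f"
    using assms(1,2) \<open>\<epsilon> > 0\<close> unfolding is_operator_exp_def eventually_sequentially by blast
  have "cmod ((\<Sum>n<N. (T ^^ n) f x / fact n) - H f x) < e" if "N \<ge> N0" for N
    using cmod_le_ell2_norm[OF conjunct1[OF N0[OF that]] assms(3)] N0[OF that] small by linarith
  then show "\<exists>N0. \<forall>N\<ge>N0. norm ((\<Sum>n<N. (T ^^ n) f x / fact n) - H f x) < e" by blast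
qed

definition point_mass :: "'b \<Rightarrow> 'b \<Rightarrow> complex" where
  "point_mass y x = of_bool (x = y)"

lemma point_mass_ell2: "point_mass y \<in> ell2 X"
proof (rule ell2_bounded_sums(1)[where B = 1])
  fix F :: "'a set" assume F: "finite F"
  have "(\<Sum>x\<in>F. (cmod (point_mass y x))\<^sup>2) = (\<Sum>x\<in>F. if x = y then 1 else 0)"
    by (intro sum.cong) (auto simp: point_mass_def)
  also have "\<dots> \<le> 1" using F by simp
  finally show "L2_set (\<lambda>x. cmod (point_mass y x)) F \<le> 1" by (simp add: L2_set_def)
qed simp

text \<open>
  Linearity is required on all functions, not only on the square-summable ones, since operators
  act on all functions here.
\<close>

definition linear_operator :: "(('b \<Rightarrow> complex) \<Rightarrow> 'b \<Rightarrow> complex) \<Rightarrow> bool" where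
  "linear_operator T \<longleftrightarrow>
     (\<forall>f g. T (\<lambda>x. f x + g x) = (\<lambda>x. T f x + T g x)) \<and> (\<forall>c f. T (\<lambda>x. c * f x) = (\<lambda>x. c * T f x))"

lemma linear_operator_funpow:
  assumes "linear_operator T"
  shows "(T ^^ n) (\<lambda>x. f x + g x) = (\<lambda>x. (T ^^ n) f x + (T ^^ n) g x)"
    and "(T ^^ n) (\<lambda>x. c * f x) = (\<lambda>x. c * (T ^^ n) f x)"
  using assms by (induction n) (auto simp: linear_operator_def)

lemma linear_operator_funpow_sum:
  assumes "linear_operator T" "finite F"
  shows "(T ^^ n) (\<lambda>x. (\<Sum>y\<in>F. c y * g y x) + h x) = (\<lambda>x. (\<Sum>y\<in>F. c y * (T ^^ n) (g y) x) + (T ^^ n) h x)"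
  using assms(2)
  by (induction F rule: finite_induct)
     (simp_all add: add.assoc linear_operator_funpow[OF assms(1)])

lemma ell2_norm_off_finite_tendsto:
  assumes "f \<in> ell2 X"
  shows "((\<lambda>F. ell2_norm X (\<lambda>x. if x \<in> F then 0 else f x)) \<longlongrightarrow> 0) (finite_subsets_at_top X)"
proof -
  let ?g = "\<lambda>x. (cmod (f x))\<^sup>2"
  have g: "?g summable_on X" using assms by (simp add: ell2_def)
  have "ell2_norm X (\<lambda>x. if x \<in> F then 0 else f x) = sqrt (infsum ?g X - sum ?g F)"
    if F: "finite F" "F \<subseteq> X" for F
  proof -
    have "(\<Sum>\<^sub>\<infinity>x\<in>X. (cmod (if x \<in> F then 0 else f x))\<^sup>2) = infsum ?g (X - F)"
      by (rule infsum_cong_neutral) auto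
    also have "\<dots> = infsum ?g X - infsum ?g F"
      by (rule infsum_Diff) (use g F in auto)
    finally show ?thesis using F by (simp add: ell2_norm_def)
  qed
  then have ev: "\<forall>\<^sub>F F in finite_subsets_at_top X.
      sqrt (infsum ?g X - sum ?g F) = ell2_norm X (\<lambda>x. if x \<in> F then 0 else f x)"
    by (intro eventually_finite_subsets_at_top_weakI) simp
  have "(sum ?g \<longlongrightarrow> infsum ?g X) (finite_subsets_at_top X)"
    using has_sum_infsum[OF g] by (simp add: has_sum_def)
  then have "((\<lambda>F. sqrt (infsum ?g X - sum ?g F)) \<longlongrightarrow> sqrt (infsum ?g X - infsum ?g X)) (finite_subsets_at_top X)"
    by (intro tendsto_intros)
  then show ?thesis using tendsto_cong[OF ev] by simp
qed

lemma ell2_off_set: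
  assumes "f \<in> ell2 X" shows "(\<lambda>x. if x \<in> F then 0 else f x) \<in> ell2 X"
proof (rule ell2_bounded_sums(1)[where B = "ell2_norm X f"])
  fix A assume A: "finite A" "A \<subseteq> X"
  have "L2_set (\<lambda>x. cmod (if x \<in> F then 0 else f x)) A \<le> L2_set (\<lambda>x. cmod (f x)) A"
    by (intro L2_set_mono) auto
  then show "L2_set (\<lambda>x. cmod (if x \<in> F then 0 else f x)) A \<le> ell2_norm X f"
    using L2_set_le_ell2_norm[OF assms A] by linarith
qed simp

text \<open>
  A bounded operator is determined by its matrix entries: cutting \<open>f\<close> off outside a finite set \<open>F\<close>
  leaves a linear combination of point masses, and the remainder tends to zero in norm as \<open>F\<close> grows.
\<close>

lemma exp_series_kernel:
  assumes T: "bounded_on_ell2 X T C" "linear_operator T" and f: "f \<in> ell2 X" and x: "x \<in> X"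
  shows "((\<lambda>y. exp_series T (point_mass y) x * f y) has_sum exp_series T f x) X"
proof -
  let ?H = "exp_series T" and ?r = "\<lambda>F x. if x \<in> F then 0 else f x"
  have sums: "(\<lambda>n. (T ^^ n) g x / fact n) sums ?H g x" if "g \<in> ell2 X" for g
    using exp_series_summable[OF T(1) that x] by (simp add: exp_series_def summable_sums)
  have split: "(\<Sum>y\<in>F. ?H (point_mass y) x * f y) = ?H f x - ?H (?r F) x"
    if F: "finite F" "F \<subseteq> X" for F
  proof -
    have "f = (\<lambda>x. (\<Sum>y\<in>F. f y * point_mass y x) + ?r F x)"
    proof
      fix z
      have "(\<Sum>y\<in>F. f y * point_mass y z) = (\<Sum>y\<in>F. if z = y then f y else 0)"
        by (intro sum.cong) (auto simp: point_mass_def)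
      then show "f z = (\<Sum>y\<in>F. f y * point_mass y z) + ?r F z" using F by simp
    qed
    then have "(T ^^ n) f x / fact n =
        (\<Sum>y\<in>F. f y * ((T ^^ n) (point_mass y) x / fact n)) + (T ^^ n) (?r F) x / fact n" for n
      using linear_operator_funpow_sum[OF T(2) F(1), of n f point_mass "?r F"]
      by (simp add: add_divide_distrib sum_divide_distrib)
    moreover have "(\<lambda>n. (\<Sum>y\<in>F. f y * ((T ^^ n) (point_mass y) x / fact n)) + (T ^^ n) (?r F) x / fact n)
        sums ((\<Sum>y\<in>F. f y * ?H (point_mass y) x) + ?H (?r F) x)"
      by (intro sums_add sums_sum sums_mult sums point_mass_ell2 ell2_off_set f)
    ultimately have "?H f x = (\<Sum>y\<in>F. f y * ?H (point_mass y) x) + ?H (?r F) x"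
      using sums[OF f] sums_unique2 by simp
    then show ?thesis by (simp add: mult.commute)
  qed
  have "((\<lambda>F. exp C * ell2_norm X (?r F)) \<longlongrightarrow> 0) (finite_subsets_at_top X)"
    by (rule tendsto_mult_right_zero[OF ell2_norm_off_finite_tendsto[OF f]])
  then have "((\<lambda>F. ?H (?r F) x) \<longlongrightarrow> 0) (finite_subsets_at_top X)"
    by (rule Lim_null_comparison[rotated])
       (auto intro!: always_eventually cmod_exp_series_le[OF T(1) ell2_off_set[OF f] x])
  from tendsto_diff[OF tendsto_const this, of "?H f x"]
  have "((\<lambda>F. ?H f x - ?H (?r F) x) \<longlongrightarrow> ?H f x) (finite_subsets_at_top X)" by simp
  moreover have "\<forall>\<^sub>F F in finite_subsets_at_top X.
      (\<Sum>y\<in>F. ?H (point_mass y) x * f y) = ?H f x - ?H (?r F) x"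
    by (intro eventually_finite_subsets_at_top_weakI split)
  ultimately show ?thesis unfolding has_sum_def using tendsto_cong by fastforce
qed

section \<open>The heat kernel of a Cayley graph as a power series\<close>

lemma linear_operator_cayley_laplacian:
  "linear_operator (\<lambda>f x. c * cayley_laplacian A S f x)"
  by (auto simp: linear_operator_def cayley_laplacian_def fun_eq_iff algebra_simps
      sum.distrib add_divide_distrib sum_distrib_left)

text \<open>
  Each right translation is an isometry of the square-summable functions; the triangle inequality gives the
  bound. It is not sharp, but any bound independent of \<open>f\<close> serves.
\<close>

lemma (in group) bounded_on_ell2_cayley_laplacian:
  assumes S: "finite S" "S \<subseteq> carrier G"
  shows "bounded_on_ell2 (carrier G) (\<lambda>f x. c * cayley_laplacian G S f x) (cmod c * (1 + real (card S)))"
  unfolding bounded_on_ell2_def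
proof (intro conjI ballI)
  let ?N = "ell2_norm (carrier G)" and ?C = "cmod c * (1 + real (card S))"
  show "0 \<le> ?C" by simp
  fix f assume f: "f \<in> ell2 (carrier G)"
  have "L2_set (\<lambda>x. cmod (c * cayley_laplacian G S f x)) F \<le> ?C * ?N f"
    if F: "finite F" "F \<subseteq> carrier G" for F
  proof -
    have sh: "L2_set (\<lambda>x. cmod (f (x \<otimes> a))) F \<le> ?N f" if "a \<in> S" for a
    proof -
      have a: "a \<in> carrier G" using that S by auto
      have inj: "inj_on (\<lambda>x. x \<otimes> a) F" using F a by (intro inj_onI) (metis right_cancel subsetD)
      have "L2_set (\<lambda>x. cmod (f (x \<otimes> a))) F = L2_set (\<lambda>x. cmod (f x)) ((\<lambda>x. x \<otimes> a) ` F)"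
        using inj by (simp add: L2_set_def sum.reindex)
      also have "\<dots> \<le> ?N f" using f F a by (intro L2_set_le_ell2_norm) auto
      finally show ?thesis .
    qed
    have "cmod (cayley_laplacian G S f x) \<le> cmod (f x) + cmod (\<Sum>a\<in>S. f (x \<otimes> a))" for x
    proof -
      have "cmod (cayley_laplacian G S f x) \<le> cmod (f x) + cmod ((\<Sum>a\<in>S. f (x \<otimes> a)) / of_nat (card S))"
        unfolding cayley_laplacian_def by (rule norm_triangle_ineq4)
      also have "cmod ((\<Sum>a\<in>S. f (x \<otimes> a)) / of_nat (card S)) \<le> cmod (\<Sum>a\<in>S. f (x \<otimes> a))"
      proof (cases "card S = 0")
        case False
        then have "1 * cmod (\<Sum>a\<in>S. f (x \<otimes> a)) \<le> real (card S) * cmod (\<Sum>a\<in>S. f (x \<otimes> a))"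
          by (intro mult_right_mono) auto
        then show ?thesis using False by (simp add: norm_divide divide_le_eq mult.commute)
      qed simp
      finally show ?thesis by simp
    qed
    then have "L2_set (\<lambda>x. cmod (cayley_laplacian G S f x)) F
        \<le> L2_set (\<lambda>x. cmod (f x) + cmod (\<Sum>a\<in>S. f (x \<otimes> a))) F"
      by (intro L2_set_mono) auto
    also have "\<dots> \<le> L2_set (\<lambda>x. cmod (f x)) F + L2_set (\<lambda>x. cmod (\<Sum>a\<in>S. f (x \<otimes> a))) F"
      by (rule L2_set_triangle_ineq)
    also have "\<dots> \<le> ?N f + (\<Sum>a\<in>S. ?N f)"
      by (intro add_mono L2_set_le_ell2_norm f F order_trans[OF L2_set_sum_le[OF S(1)]] sum_mono sh)
    finally have "L2_set (\<lambda>x. cmod (cayley_laplacian G S f x)) F \<le> (1 + real (card S)) * ?N f"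
      by (simp add: algebra_simps)
    then have "cmod c * L2_set (\<lambda>x. cmod (cayley_laplacian G S f x)) F \<le> ?C * ?N f"
      by (simp add: mult.assoc mult_left_mono)
    then show ?thesis by (simp add: norm_mult L2_set_right_distrib)
  qed
  from ell2_bounded_sums[OF _ this]
  show "(\<lambda>x. c * cayley_laplacian G S f x) \<in> ell2 (carrier G)"
    "?N (\<lambda>x. c * cayley_laplacian G S f x) \<le> ?C * ?N f" by auto
qed

text \<open>
  Right multiplications commute with left translations, so the powers of the Laplacian applied to different
  point masses are translates of each other.
\<close>

lemma (in group) cayley_laplacian_funpow_point_mass:
  assumes S: "S \<subseteq> carrier G" and y: "y \<in> carrier G" and x: "x \<in> carrier G"
  shows "((\<lambda>f x. c * cayley_laplacian G S f x) ^^ n) (point_mass y) x =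
    ((\<lambda>f x. c * cayley_laplacian G S f x) ^^ n) (point_mass \<one>) (inv y \<otimes> x)"
  using x
proof (induction n arbitrary: x)
  case 0
  have "inv y \<otimes> x = \<one> \<longleftrightarrow> x = y" using y 0 by (metis inv_closed inv_equality inv_inv l_inv)
  then show ?case by (simp add: point_mass_def)
next
  case (Suc n)
  have "a \<in> carrier G" if "a \<in> S" for a using that S by auto
  then show ?case using Suc y
    by (simp add: cayley_laplacian_def m_assoc cong: sum.cong)
qed

text \<open>
  One direction tests the kernel on the point mass at the identity; the other assembles the
  operator from its matrix entries, which by translation invariance depend only on \<open>inv y \<otimes> x\<close>.
\<close>

lemma (in group) is_heat_kernel_iff:
  assumes S: "finite S" "S \<subseteq> carrier G"
  shows "is_heat_kernel G S k \<longleftrightarrow> (\<forall>t\<ge>0. \<forall>x\<in>carrier G.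
    (\<lambda>n. ((\<lambda>f x. - of_real t * cayley_laplacian G S f x) ^^ n) (point_mass \<one>) x / fact n)
      sums of_real (k t x))"
    (is "_ \<longleftrightarrow> (\<forall>t\<ge>0. \<forall>x\<in>carrier G. ?P t x)")
proof (intro iffI allI impI ballI)
  fix t :: real and x assume k: "is_heat_kernel G S k" and "t \<ge> 0" and x: "x \<in> carrier G"
  then obtain H where H: "is_heat_operator G S t H"
      "((\<lambda>y. of_real (k t (inv y \<otimes> x)) * point_mass \<one> y) has_sum H (point_mass \<one>) x) (carrier G)"
    unfolding is_heat_kernel_def using point_mass_ell2[of "\<one>" "carrier G"] by metis
  have "((\<lambda>y. of_real (k t (inv y \<otimes> x)) * point_mass \<one> y) has_sum of_real (k t x)) {\<one>}"
    by (rule has_sum_finiteI) (use x in \<open>auto simp: point_mass_def\<close>)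
  then have "((\<lambda>y. of_real (k t (inv y \<otimes> x)) * point_mass \<one> y) has_sum of_real (k t x)) (carrier G)"
    by (subst (asm) has_sum_cong_neutral) (auto simp: point_mass_def)
  then have "H (point_mass \<one>) x = of_real (k t x)"
    using H(2) by (rule has_sum_unique[rotated])
  then show "?P t x"
    using is_operator_exp_sums[OF H(1)[unfolded is_heat_operator_def] point_mass_ell2[of "\<one>"] x]
    by (simp only:)
next
  assume *: "\<forall>t\<ge>0. \<forall>x\<in>carrier G. ?P t x"
  show "is_heat_kernel G S k"
    unfolding is_heat_kernel_def
  proof (intro allI impI)
    fix t :: real assume t: "t \<ge> 0"
    let ?T = "\<lambda>f x. - of_real t * cayley_laplacian G S f x"
    note T = bounded_on_ell2_cayley_laplacian[OF S, of "- of_real t"] linear_operator_cayley_laplacian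
    have k: "exp_series ?T (point_mass y) x = of_real (k t (inv y \<otimes> x))"
      if "x \<in> carrier G" "y \<in> carrier G" for x y
      using *[rule_format, OF t, of "inv y \<otimes> x"] that
        cayley_laplacian_funpow_point_mass[OF S(2) that(2,1), where c = "- of_real t"]
      by (simp add: exp_series_def sums_iff)
    show "\<exists>H. is_heat_operator G S t H \<and> (\<forall>f\<in>ell2 (carrier G). \<forall>x\<in>carrier G.
        ((\<lambda>y. of_real (k t (inv y \<otimes> x)) * f y) has_sum H f x) (carrier G))"
    proof (intro exI conjI ballI)
      show "is_heat_operator G S t (exp_series ?T)"
        unfolding is_heat_operator_def by (rule is_operator_exp_exp_series[OF T(1)])
      fix f x assume f: "f \<in> ell2 (carrier G)" and x: "x \<in> carrier G"
      have "((\<lambda>y. of_real (k t (inv y \<otimes> x)) * f y) has_sum exp_series ?T f x) (carrier G) \<longleftrightarrow>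
          ((\<lambda>y. exp_series ?T (point_mass y) x * f y) has_sum exp_series ?T f x) (carrier G)"
        by (rule has_sum_cong) (simp only: k[OF x])
      then show "((\<lambda>y. of_real (k t (inv y \<otimes> x)) * f y) has_sum exp_series ?T f x) (carrier G)"
        using exp_series_kernel[OF T f x] by (simp only:)
    qed
  qed
qed

section \<open>Radial functions on a free product of finite groups\<close>

lemma foldr_letter_mult_append:
  "u @ v \<in> reduced_words I G \<Longrightarrow> foldr (letter_mult G) u v = u @ v"
proof (induction u)
  case (Cons l u)
  obtain i a where l: "l = (i, a)" by (cases l)
  with Cons.prems have "(i, a) # (u @ v) \<in> reduced_words I G" by simp
  moreover from this have "u @ v \<in> reduced_words I G" by (simp add: reduced_words_Cons)
  ultimately show ?case using Cons.IH letter_mult_Cons_reduced[of i a "u @ v" I G] by (simp add: l)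
qed simp

lemma reduced_words_snoc:
  "w @ [(j, a)] \<in> reduced_words I G \<longleftrightarrow>
     j \<in> I \<and> a \<in> carrier (G j) \<and> a \<noteq> \<one>\<^bsub>G j\<^esub> \<and> w \<in> reduced_words I G \<and>
     (w = [] \<or> fst (last w) \<noteq> j)"
  by (auto simp: reduced_words_def successively_append_iff)

text \<open>
  The three ways in which a generator can change a nonempty word: it lengthens it, cancels
  the last letter, or replaces that letter by another one of the same factor.
\<close>

lemma foldr_letter_mult_snoc:
  assumes x: "u @ [(i, b)] \<in> reduced_words I G" and a: "j \<in> I" "a \<in> carrier (G j) - {\<one>\<^bsub>G j\<^esub>}"
    and G: "group (G i)"
  shows "foldr (letter_mult G) (u @ [(i, b)]) [(j, a)] =
    (if j \<noteq> i then u @ [(i, b), (j, a)] else if b \<otimes>\<^bsub>G i\<^esub> a = \<one>\<^bsub>G i\<^esub> then u else u @ [(i, b \<otimes>\<^bsub>G i\<^esub> a)])"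
proof -
  interpret group "G i" by fact
  have b: "i \<in> I" "b \<in> carrier (G i)" "b \<noteq> \<one>\<^bsub>G i\<^esub>" "u \<in> reduced_words I G" "u = [] \<or> fst (last u) \<noteq> i"
    using x by (auto simp: reduced_words_snoc)
  show ?thesis
  proof (cases "j = i")
    case False
    have "(u @ [(i, b)]) @ [(j, a)] \<in> reduced_words I G"
      using x a False by (subst reduced_words_snoc) auto
    from foldr_letter_mult_append[OF this] show ?thesis
      using False by (simp del: foldr_append letter_mult.simps)
  next
    case True
    have "u @ [(i, b \<otimes>\<^bsub>G i\<^esub> a)] \<in> reduced_words I G" if "b \<otimes>\<^bsub>G i\<^esub> a \<noteq> \<one>\<^bsub>G i\<^esub>"
      using b a True that by (auto simp: reduced_words_snoc)
    then show ?thesis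
      using True b foldr_letter_mult_append[of u "[]" I G]
        foldr_letter_mult_append[of u "[(i, b \<otimes>\<^bsub>G i\<^esub> a)]" I G] by auto
  qed
qed

lemma factor_generators_eq:
  "factor_generators I G = (\<lambda>(i, a). [(i, a)]) ` (SIGMA i:I. carrier (G i) - {\<one>\<^bsub>G i\<^esub>})"
  by (auto simp: factor_generators_def)

lemma sum_factor_generators:
  assumes "finite I" "\<And>i. i \<in> I \<Longrightarrow> finite (carrier (G i))"
  shows "sum h (factor_generators I G) = (\<Sum>i\<in>I. \<Sum>a\<in>carrier (G i) - {\<one>\<^bsub>G i\<^esub>}. h [(i, a)])"
proof -
  have "inj_on (\<lambda>(i, a). [(i, a)]) (SIGMA i:I. carrier (G i) - {\<one>\<^bsub>G i\<^esub>})"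
    by (auto intro!: inj_onI)
  then have "sum h (factor_generators I G) =
      (\<Sum>(i, a)\<in>(SIGMA i:I. carrier (G i) - {\<one>\<^bsub>G i\<^esub>}). h [(i, a)])"
    unfolding factor_generators_eq by (subst sum.reindex) (auto intro!: sum.cong)
  then show ?thesis by (subst sum.Sigma) (use assms in auto)
qed

locale finite_factors =
  fixes I :: "'i set" and G :: "'i \<Rightarrow> ('a, 'c) monoid_scheme" and L :: nat
  assumes finite_index: "finite I" and index_nonempty: "I \<noteq> {}"
    and factor_group: "\<And>i. i \<in> I \<Longrightarrow> group (G i)"
    and factor_finite: "\<And>i. i \<in> I \<Longrightarrow> finite (carrier (G i))"
    and factor_card: "\<And>i. i \<in> I \<Longrightarrow> card (carrier (G i)) = L"
    and factor_nontrivial: "L \<ge> 2"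
begin

abbreviation "q \<equiv> real L - 1"
abbreviation "s \<equiv> real (card I) - 1"

lemma index_card_pos: "card I \<ge> 1"
  using finite_index index_nonempty by (simp add: Suc_leI card_gt_0_iff)

lemma card_letters: "i \<in> I \<Longrightarrow> real (card (carrier (G i) - {\<one>\<^bsub>G i\<^esub>})) = q"
  using factor_card[of i] factor_finite[of i] factor_nontrivial group.is_monoid[OF factor_group, of i]
  by (simp add: card_Diff_singleton monoid.one_closed of_nat_diff)

lemma finite_factor_generators: "finite (factor_generators I G)"
  unfolding factor_generators_eq using finite_index factor_finite by auto

lemma factor_generators_carrier: "factor_generators I G \<subseteq> carrier (free_product I G)"
  by (auto simp: factor_generators_def free_product_def reduced_words_Cons)

lemma card_factor_generators: "real (card (factor_generators I G)) = (s + 1) * q"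
proof -
  have "real (card (factor_generators I G)) = (\<Sum>w\<in>factor_generators I G. 1)" by simp
  also have "\<dots> = (\<Sum>i\<in>I. q)"
    by (subst sum_factor_generators) (auto simp: finite_index factor_finite card_letters intro!: sum.cong)
  finally show ?thesis by simp
qed

text \<open>
  If the word is nonempty with last letter in the factor \<open>i\<close>, then the generators of the other factors
  lengthen it, and among those of \<open>G i\<close> exactly one, the inverse of the last letter, shortens it.
\<close>

lemma sum_length_mult_generator:
  fixes F :: "nat \<Rightarrow> real"
  assumes x: "x \<in> carrier (free_product I G)"
  defines "n \<equiv> length x"
  shows "(\<Sum>w\<in>factor_generators I G. F (length (x \<otimes>\<^bsub>free_product I G\<^esub> w))) =
    (if n = 0 then (s + 1) * q * F 1 else s * q * F (n + 1) + (q - 1) * F n + F (n - 1))"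
proof (cases x rule: rev_exhaust)
  case Nil
  have "(\<Sum>w\<in>factor_generators I G. F (length (x \<otimes>\<^bsub>free_product I G\<^esub> w))) =
      (\<Sum>w\<in>factor_generators I G. F 1)"
    by (intro sum.cong) (auto simp: Nil free_product_def factor_generators_def)
  then show ?thesis using Nil card_factor_generators by (simp add: n_def)
next
  case (snoc u l)
  obtain i b where l: "l = (i, b)" by (cases l)
  have x': "u @ [(i, b)] \<in> reduced_words I G" using x unfolding snoc l by (simp add: free_product_def)
  have b: "i \<in> I" "b \<in> carrier (G i)" "b \<noteq> \<one>\<^bsub>G i\<^esub>" using x' by (auto simp: reduced_words_snoc)
  interpret group "G i" using factor_group b by simp
  let ?A = "\<lambda>j. carrier (G j) - {\<one>\<^bsub>G j\<^esub>}"
  let ?h = "\<lambda>j a. F (length (x \<otimes>\<^bsub>free_product I G\<^esub> [(j, a)]))"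
  have n: "n = Suc (length u)" by (simp add: n_def snoc)
  have h: "?h j a = (if j \<noteq> i then F (n + 1) else if b \<otimes>\<^bsub>G i\<^esub> a = \<one>\<^bsub>G i\<^esub> then F (n - 1) else F n)"
    if "j \<in> I" "a \<in> ?A j" for j a
    using foldr_letter_mult_snoc[OF x' that is_group]
    unfolding n snoc l by (auto simp: free_product_def simp del: foldr_append)
  have other: "(\<Sum>a\<in>?A j. ?h j a) = q * F (n + 1)" if "j \<in> I - {i}" for j
    using that h card_letters[of j] by (simp add: sum.cong)
  have same: "(\<Sum>a\<in>?A i. ?h i a) = (q - 1) * F n + F (n - 1)"
  proof -
    have inv: "inv\<^bsub>G i\<^esub> b \<in> ?A i" using b by auto
    have fin: "finite (?A i)" using factor_finite b by simp
    have one: "b \<otimes>\<^bsub>G i\<^esub> a = \<one>\<^bsub>G i\<^esub> \<longleftrightarrow> a = inv\<^bsub>G i\<^esub> b" if "a \<in> ?A i" for a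
      using that b by (metis DiffD1 inv_closed inv_equality inv_inv r_inv)
    have "(\<Sum>a\<in>?A i. ?h i a) = ?h i (inv\<^bsub>G i\<^esub> b) + (\<Sum>a\<in>?A i - {inv\<^bsub>G i\<^esub> b}. ?h i a)"
      by (rule sum.remove[OF fin inv])
    also have "(\<Sum>a\<in>?A i - {inv\<^bsub>G i\<^esub> b}. ?h i a) = (\<Sum>a\<in>?A i - {inv\<^bsub>G i\<^esub> b}. F n)"
      by (intro sum.cong refl) (use h b one in auto)
    also have "\<dots> = (real (card (?A i)) - 1) * F n"
    proof -
      have "card (?A i) \<ge> 1" using fin inv by (metis One_nat_def Suc_leI card_gt_0_iff empty_iff)
      then show ?thesis using card_Diff_singleton[OF inv] by (simp add: of_nat_diff)
    qed
    also have "?h i (inv\<^bsub>G i\<^esub> b) = F (n - 1)" using h[OF b(1) inv] b by simp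
    finally show ?thesis using card_letters[OF b(1)] by simp
  qed
  have "(\<Sum>w\<in>factor_generators I G. F (length (x \<otimes>\<^bsub>free_product I G\<^esub> w))) =
      (\<Sum>j\<in>I. \<Sum>a\<in>?A j. ?h j a)"
    by (rule sum_factor_generators[OF finite_index factor_finite])
  also have "\<dots> = (\<Sum>a\<in>?A i. ?h i a) + (\<Sum>j\<in>I - {i}. \<Sum>a\<in>?A j. ?h j a)"
    by (rule sum.remove[OF finite_index b(1)])
  also have "(\<Sum>j\<in>I - {i}. \<Sum>a\<in>?A j. ?h j a) = (\<Sum>j\<in>I - {i}. q * F (n + 1))"
    by (rule sum.cong[OF refl other])
  also have "\<dots> = s * (q * F (n + 1))"
    using card_Diff_singleton[OF b(1)] index_card_pos by (simp add: of_nat_diff)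
  finally show ?thesis unfolding same using n by simp
qed

end

definition radial_laplacian :: "real \<Rightarrow> real \<Rightarrow> (nat \<Rightarrow> real) \<Rightarrow> nat \<Rightarrow> real" where
  "radial_laplacian q s F n =
     F n - (if n = 0 then F 1 else (s * q * F (n + 1) + (q - 1) * F n + F (n - 1)) / ((s + 1) * q))"

lemma radial_laplacian_add: "radial_laplacian q s (\<lambda>n. F n + H n) n = radial_laplacian q s F n + radial_laplacian q s H n"
  by (cases n) (simp_all add: radial_laplacian_def add_divide_distrib distrib_left)

lemma radial_laplacian_mult: "radial_laplacian q s (\<lambda>n. c * F n) n = c * radial_laplacian q s F n"
  by (simp add: radial_laplacian_def algebra_simps add_divide_distrib)

lemma radial_laplacian_integral:
  assumes "\<And>n. f n integrable_on A"
  shows "radial_laplacian q s (\<lambda>n. integral A (f n)) n = integral A (\<lambda>x. radial_laplacian q s (\<lambda>n. f n x) n)"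
proof -
  have "((\<lambda>x. radial_laplacian q s (\<lambda>n. f n x) n) has_integral radial_laplacian q s (\<lambda>n. integral A (f n)) n) A"
    unfolding radial_laplacian_def using assms
    by (cases n) (auto intro!: has_integral_diff has_integral_divide has_integral_add has_integral_mult_right integrable_integral)
  then show ?thesis by (rule integral_unique[symmetric])
qed

context finite_factors begin

lemma cayley_laplacian_radial:
  assumes f: "\<And>x. x \<in> carrier (free_product I G) \<Longrightarrow> f x = of_real (F (length x))"
    and x: "x \<in> carrier (free_product I G)"
  shows "cayley_laplacian (free_product I G) (factor_generators I G) f x =
    of_real (radial_laplacian q s F (length x))"
proof -
  interpret A: group "free_product I G" by (rule free_product_group[OF factor_group])
  have "(\<Sum>w\<in>factor_generators I G. f (x \<otimes>\<^bsub>free_product I G\<^esub> w)) =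
      of_real (\<Sum>w\<in>factor_generators I G. F (length (x \<otimes>\<^bsub>free_product I G\<^esub> w)))"
    unfolding of_real_sum
    by (intro sum.cong refl f) (use x factor_generators_carrier in auto)
  moreover have "(of_nat (card (factor_generators I G)) :: complex) = of_real ((s + 1) * q)"
    unfolding card_factor_generators[symmetric] by simp
  moreover have "(s + 1) * q \<noteq> 0" using factor_nontrivial index_card_pos by simp
  ultimately show ?thesis
    unfolding cayley_laplacian_def sum_length_mult_generator[OF x] f[OF x] radial_laplacian_def
    by (simp flip: of_real_divide of_real_diff of_real_mult)
qed

lemma cayley_laplacian_funpow_radial:
  assumes x: "x \<in> carrier (free_product I G)"
  shows "((\<lambda>f x. of_real c * cayley_laplacian (free_product I G) (factor_generators I G) f x) ^^ m)
      (point_mass \<one>\<^bsub>free_product I G\<^esub>) x =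
    of_real (c ^ m * (radial_laplacian q s ^^ m) (\<lambda>n. of_bool (n = 0)) (length x))"
  using x
proof (induction m arbitrary: x)
  case 0
  then show ?case by (simp add: point_mass_def free_product_def)
next
  case (Suc m)
  let ?F = "(radial_laplacian q s ^^ m) (\<lambda>n. of_bool (n = 0))"
  have "radial_laplacian q s (\<lambda>n. c ^ m * ?F n) = (\<lambda>n. c ^ m * radial_laplacian q s ?F n)"
    by (auto simp: radial_laplacian_def fun_eq_iff algebra_simps add_divide_distrib)
  with cayley_laplacian_radial[where F = "\<lambda>n. c ^ m * ?F n", OF Suc.IH Suc.prems] show ?case by simp
qed

end

section \<open>Integrals attached to a simple pole\<close>

text \<open>
  Unrolling the recursion gives \<open>a 0 = c ^ k * a k\<close>, which tends to zero. This selects the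
  bounded solution of the recursions below.
\<close>

lemma bounded_geometric_zero:
  fixes a :: "nat \<Rightarrow> real"
  assumes c: "\<bar>c\<bar> < 1" and rec: "\<And>k. a k = c * a (Suc k)" and bd: "\<And>k. \<bar>a k\<bar> \<le> B"
  shows "a 0 = 0"
proof -
  have eq: "a 0 = c ^ k * a k" for k
  proof (induction k)
    case (Suc k)
    then show ?case using rec[of k] by simp
  qed simp
  have "(\<lambda>k. \<bar>c\<bar> ^ k * B) \<longlonglongrightarrow> 0"
    using c by (intro tendsto_mult_left_zero LIMSEQ_power_zero) simp
  moreover have "\<bar>a 0\<bar> \<le> \<bar>c\<bar> ^ k * B" for k
    using bd[of k] by (subst eq[of k]) (simp add: abs_mult power_abs mult_left_mono)
  ultimately have "\<bar>a 0\<bar> \<le> 0" by (intro LIMSEQ_le_const) auto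
  then show ?thesis by simp
qed

lemma integral_cos_multiple:
  "((\<lambda>x. cos (real_of_int m * x)) has_integral (if m = 0 then pi else 0)) {0..pi}"
proof (cases "m = 0")
  case True
  then show ?thesis using has_integral_const_real[of "1::real" 0 pi] by simp
next
  case False
  have "((\<lambda>x. cos (real_of_int m * x)) has_integral
      (sin (real_of_int m * pi) / m - sin (real_of_int m * 0) / m)) {0..pi}"
    by (rule fundamental_theorem_of_calculus)
       (use False in \<open>auto intro!: derivative_eq_intros simp flip: has_real_derivative_iff_has_vector_derivative\<close>)
  moreover have "sin (real_of_int m * pi) = 0" by (simp add: sin_zero_iff_int2)
  ultimately show ?thesis using False by simp
qed

lemma integral_sin_sin_multiple:
  "((\<lambda>x. sin x * sin (real_of_int m * x)) has_integral
     (if m = 1 then pi / 2 else if m = -1 then - pi / 2 else 0)) {0..pi}"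
proof -
  have eq: "sin x * sin (real_of_int m * x) =
      (cos (real_of_int (m - 1) * x) - cos (real_of_int (m + 1) * x)) / 2" for x
    by (simp add: cos_add cos_diff distrib_right left_diff_distrib)
  have int: "((\<lambda>x. (cos (real_of_int (m - 1) * x) - cos (real_of_int (m + 1) * x)) / 2) has_integral
      ((if m - 1 = 0 then pi else 0) - (if m + 1 = 0 then pi else 0)) / 2) {0..pi}"
    by (intro has_integral_divide has_integral_diff integral_cos_multiple)
  have val: "((if m - 1 = 0 then pi else 0) - (if m + 1 = 0 then pi else 0)) / 2 =
      (if m = 1 then pi / 2 else if m = -1 then - pi / 2 else 0)" by auto
  show ?thesis unfolding eq using int unfolding val .
qed

text \<open>
  With \<open>z = exp (\<i> x)\<close> this is \<open>sin x\<close> times the imaginary part of \<open>z ^ (m + 1) / (c - z)\<close>. For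
  \<open>c = 1\<close> and \<open>c = -1\<close> that expression is undefined at one end of the interval \<open>[0, \<pi>]\<close>, where
  \<open>sin x\<close> vanishes too; the first branch is its continuous extension. The exponent is an integer because the case
  \<open>\<bar>c\<bar> < 1\<close> is solved by descending to \<open>m = -\<infinity>\<close>.
\<close>

definition pole_integrand :: "real \<Rightarrow> int \<Rightarrow> real \<Rightarrow> real" where
  "pole_integrand c m x =
     (if \<bar>c\<bar> = 1 then (cos (real_of_int (m + 1) * x) + c * cos (real_of_int m * x)) / 2
      else sin x * (c * sin (real_of_int (m + 1) * x) - sin (real_of_int m * x)) / (c\<^sup>2 - 2 * c * cos x + 1))"

lemma pole_denominator_ge: "c\<^sup>2 - 2 * c * cos x + 1 \<ge> (\<bar>c\<bar> - 1)\<^sup>2" for c x :: real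
proof -
  have "c * cos x \<le> \<bar>c\<bar> * 1"
    using mult_left_mono[OF abs_cos_le_one[of x], of "\<bar>c\<bar>"] abs_ge_self[of "c * cos x"]
    unfolding abs_mult by linarith
  then show ?thesis by (simp add: power2_eq_square algebra_simps)
qed

lemma pole_denominator_pos:
  fixes c x :: real
  assumes "\<bar>c\<bar> \<noteq> 1 \<or> sin x \<noteq> 0"
  shows "c\<^sup>2 - 2 * c * cos x + 1 > 0"
proof -
  have "c\<^sup>2 - 2 * c * cos x + 1 = (c - cos x)\<^sup>2 + (sin x)\<^sup>2"
    by (simp add: sin_squared_eq power2_eq_square algebra_simps)
  then show ?thesis
    using assms pole_denominator_ge[of c x] zero_less_power2[of "\<bar>c\<bar> - 1"]
    by (cases "sin x = 0") (auto simp: add_nonneg_pos)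
qed

lemma pole_integrand_eq:
  assumes "sin x \<noteq> 0"
  shows "pole_integrand c m x =
    sin x * (c * sin (real_of_int (m + 1) * x) - sin (real_of_int m * x)) / (c\<^sup>2 - 2 * c * cos x + 1)"
proof (cases "\<bar>c\<bar> = 1")
  case True
  define y where "y = real_of_int m * x"
  have y: "real_of_int (m + 1) * x = y + x" "real_of_int m * x = y"
    by (simp_all add: y_def algebra_simps)
  have c2: "c\<^sup>2 = 1" using True by (metis power2_abs one_power2)
  have d: "c\<^sup>2 - 2 * c * cos x + 1 \<noteq> 0" using pole_denominator_pos[of c x] assms by auto
  have s2: "sin x * sin x = 1 - cos x * cos x" using sin_squared_eq[of x] by (simp add: power2_eq_square)
  have "(cos (y + x) + c * cos y) * (c\<^sup>2 - 2 * c * cos x + 1) = 2 * (sin x * (c * sin (y + x) - sin y))"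
  proof -
    have "(cos (y + x) + c * cos y) * (c\<^sup>2 - 2 * c * cos x + 1)
       = 2 * (cos y * cos x - sin y * sin x + c * cos y - c * cos x * (cos y * cos x - sin y * sin x) - c\<^sup>2 * cos y * cos x)"
      unfolding c2 cos_add by (simp add: algebra_simps c2 flip: power2_eq_square)
    also have "\<dots> = 2 * (c * cos y * (sin x * sin x) + c * sin y * sin x * cos x - sin y * sin x)"
      unfolding s2 c2 by (simp add: algebra_simps)
    finally show ?thesis by (simp add: sin_add algebra_simps)
  qed
  then show ?thesis unfolding pole_integrand_def y using True d by (simp add: field_simps)
qed (simp add: pole_integrand_def)

lemma continuous_on_pole_integrand: "continuous_on A (pole_integrand c m)"
proof (cases "\<bar>c\<bar> = 1")
  case True
  then show ?thesis unfolding pole_integrand_def by (auto intro!: continuous_intros)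
next
  case False
  then have "c\<^sup>2 - 2 * c * cos x + 1 \<noteq> 0" for x using pole_denominator_pos[of c x] by auto
  then show ?thesis unfolding pole_integrand_def using False by (auto intro!: continuous_intros)
qed

lemma pole_integrand_integrable: "pole_integrand c m integrable_on {0..pi}"
  by (intro integrable_continuous_real continuous_on_pole_integrand)

text \<open>
  Since \<open>c z ^ (m + 1) - z ^ (m + 2) = (c - z) z ^ (m + 1)\<close>, the denominator cancels in this
  combination and only the integral of \<open>sin x sin ((m + 1) x)\<close> remains.
\<close>

lemma integral_pole_integrand_rec:
  assumes "\<bar>c\<bar> \<noteq> 1"
  shows "c * integral {0..pi} (pole_integrand c m) - integral {0..pi} (pole_integrand c (m + 1)) =
    (if m = 0 then pi / 2 else if m = -2 then - pi / 2 else 0)"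
proof -
  have eq: "c * pole_integrand c m x - pole_integrand c (m + 1) x = sin x * sin (real_of_int (m + 1) * x)" for x
  proof -
    define y where "y = real_of_int (m + 1) * x"
    have y: "real_of_int m * x = y - x" "real_of_int (m + 1) * x = y" "real_of_int (m + 1 + 1) * x = y + x"
      by (simp_all add: y_def algebra_simps)
    define D where "D = c\<^sup>2 - 2 * c * cos x + 1"
    have D: "D \<noteq> 0" using pole_denominator_pos[of c x] assms by (auto simp: D_def)
    have "c * (sin x * (c * sin y - sin (y - x))) - sin x * (c * sin (y + x) - sin y) = sin x * sin y * D"
      by (simp add: sin_add sin_diff D_def algebra_simps power2_eq_square)
    then have "(c * (sin x * (c * sin y - sin (y - x))) - sin x * (c * sin (y + x) - sin y)) / D = sin x * sin y"
      using D by simp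
    then have "c * (sin x * (c * sin y - sin (y - x)) / D) - sin x * (c * sin (y + x) - sin y) / D = sin x * sin y"
      unfolding diff_divide_distrib times_divide_eq_right .
    then show ?thesis
      unfolding pole_integrand_def y D_def using assms by simp
  qed
  have "((\<lambda>x. c * pole_integrand c m x - pole_integrand c (m + 1) x) has_integral
      (c * integral {0..pi} (pole_integrand c m) - integral {0..pi} (pole_integrand c (m + 1)))) {0..pi}"
    by (intro has_integral_diff has_integral_mult_right integrable_integral pole_integrand_integrable)
  then have "((\<lambda>x. sin x * sin (real_of_int (m + 1) * x)) has_integral
      (c * integral {0..pi} (pole_integrand c m) - integral {0..pi} (pole_integrand c (m + 1)))) {0..pi}"
    by (simp only: eq)
  from has_integral_unique[OF this integral_sin_sin_multiple]
  show ?thesis by auto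
qed

lemma integral_pole_integrand_bounded:
  assumes "\<bar>c\<bar> \<noteq> 1"
  obtains B where "\<And>m. \<bar>integral {0..pi} (pole_integrand c m)\<bar> \<le> B"
proof
  fix m
  let ?B = "(\<bar>c\<bar> + 1) / (\<bar>c\<bar> - 1)\<^sup>2"
  have "norm (pole_integrand c m x) \<le> ?B" for x
  proof -
    have "\<bar>sin x * (c * sin (real_of_int (m + 1) * x) - sin (real_of_int m * x))\<bar> \<le> 1 * (\<bar>c\<bar> * 1 + 1)"
      unfolding abs_mult
    proof (intro mult_mono)
      have "\<bar>c * sin (real_of_int (m + 1) * x) - sin (real_of_int m * x)\<bar>
          \<le> \<bar>c\<bar> * \<bar>sin (real_of_int (m + 1) * x)\<bar> + \<bar>sin (real_of_int m * x)\<bar>"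
        unfolding abs_mult[symmetric] by (rule abs_triangle_ineq4)
      also have "\<dots> \<le> \<bar>c\<bar> * 1 + 1" by (intro add_mono mult_left_mono) auto
      finally show "\<bar>c * sin (real_of_int (m + 1) * x) - sin (real_of_int m * x)\<bar> \<le> \<bar>c\<bar> * 1 + 1" .
    qed auto
    then show ?thesis
      unfolding pole_integrand_def using assms pole_denominator_ge[of c x] pole_denominator_pos[of c x]
      by (auto simp: abs_mult abs_divide intro!: frac_le)
  qed
  then have "norm (integral {0..pi} (pole_integrand c m)) \<le> ?B * (pi - 0)"
    by (intro integral_bound continuous_on_pole_integrand) auto
  then show "\<bar>integral {0..pi} (pole_integrand c m)\<bar> \<le> ?B * (pi - 0)" by simp
qed

text \<open>
  For \<open>\<bar>c\<bar> > 1\<close> the recursion multiplies by \<open>c\<close> at each step from \<open>m = 1\<close> on, so boundedness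
  forces the values there to vanish, and the step at \<open>m = 0\<close> gives the remaining one.
\<close>

lemma integral_pole_integrand_outside:
  assumes c: "\<bar>c\<bar> \<ge> 1"
  shows "integral {0..pi} (pole_integrand c (int n)) = (if n = 0 then pi / (2 * c) else 0)"
proof (cases "\<bar>c\<bar> = 1")
  case True
  have part: "pole_integrand c (int n) =
      (\<lambda>x. (cos (real_of_int (int n + 1) * x) + c * cos (real_of_int (int n) * x)) / 2)"
    using True by (simp add: pole_integrand_def fun_eq_iff)
  have "((\<lambda>x. (cos (real_of_int (int n + 1) * x) + c * cos (real_of_int (int n) * x)) / 2) has_integral
      ((if int n + 1 = 0 then pi else 0) + c * (if int n = 0 then pi else 0)) / 2) {0..pi}"
    by (intro has_integral_divide has_integral_add has_integral_mult_right integral_cos_multiple)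
  then have "integral {0..pi} (pole_integrand c (int n)) =
      ((if int n + 1 = 0 then pi else 0) + c * (if int n = 0 then pi else 0)) / 2"
    unfolding part by (rule integral_unique)
  moreover have "c = 1 \<or> c = -1" using True by linarith
  ultimately show ?thesis by auto
next
  case False
  let ?Q = "\<lambda>m. integral {0..pi} (pole_integrand c m)"
  obtain B where B: "\<And>m. \<bar>?Q m\<bar> \<le> B" using integral_pole_integrand_bounded[OF False] by blast
  have zero: "?Q (int (Suc k)) = 0" for k
  proof -
    \<comment> \<open>The recursion is read backwards, so that the ratio has modulus less than 1.\<close>
    have "?Q (int (Suc k + i)) = 1 / c * ?Q (int (Suc k + Suc i))" for i
    proof -
      have e: "int (Suc k + i) + 1 = int (Suc k + Suc i)" by simp
      show ?thesis using integral_pole_integrand_rec[OF False, of "int (Suc k + i)"] c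
        unfolding e by (auto simp: field_simps)
    qed
    moreover have "\<bar>1 / c\<bar> < 1" using c False by simp
    ultimately have "?Q (int (Suc k + 0)) = 0"
      using bounded_geometric_zero[of "1 / c" "\<lambda>i. ?Q (int (Suc k + i))" B] B by blast
    then show ?thesis by simp
  qed
  show ?thesis
  proof (cases n)
    case 0
    then show ?thesis using integral_pole_integrand_rec[OF False, of 0] zero[of 0] c by (auto simp: field_simps)
  qed (use zero in simp)
qed

text \<open>
  For \<open>\<bar>c\<bar> < 1\<close> boundedness acts in the other direction: it forces the values at \<open>m \<le> -2\<close> to
  vanish. The steps at \<open>m = -2\<close> and \<open>m = 0\<close> of the recursion are inhomogeneous and produce the
  nonzero values.
\<close>

lemma integral_pole_integrand_inside:
  assumes c: "\<bar>c\<bar> < 1"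
  shows "integral {0..pi} (pole_integrand c 0) = c * pi / 2"
    and "integral {0..pi} (pole_integrand c (int (Suc n))) = - (1 - c\<^sup>2) * pi / 2 * c ^ n"
proof -
  let ?Q = "\<lambda>m. integral {0..pi} (pole_integrand c m)"
  have ne: "\<bar>c\<bar> \<noteq> 1" using c by simp
  note rec = integral_pole_integrand_rec[OF ne]
  obtain B where B: "\<And>m. \<bar>?Q m\<bar> \<le> B" using integral_pole_integrand_bounded[OF ne] by blast
  have "?Q (-2 - int k) = c * ?Q (-2 - int (Suc k))" for k
  proof -
    have e: "-2 - int (Suc k) + 1 = -2 - int k" by simp
    show ?thesis using rec[of "-2 - int (Suc k)"] unfolding e by simp
  qed
  then have "?Q (-2 - int 0) = 0"
    by (rule bounded_geometric_zero[OF c _ B])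
  then have Q1: "?Q (-1) = pi / 2" using rec[of "-2"] by simp
  have "?Q 0 = c * ?Q (-1)" using rec[of "-1"] by simp
  then show Q0: "?Q 0 = c * pi / 2" unfolding Q1 by simp
  show "?Q (int (Suc n)) = - (1 - c\<^sup>2) * pi / 2 * c ^ n"
  proof (induction n)
    case 0
    then show ?case using rec[of 0] Q0 by (simp add: power2_eq_square algebra_simps)
  next
    case (Suc n)
    have e: "int (Suc n) + 1 = int (Suc (Suc n))" by simp
    have "?Q (int (Suc (Suc n))) = c * ?Q (int (Suc n))" using rec[of "int (Suc n)"] unfolding e by simp
    then show ?case unfolding Suc by simp
  qed
qed

section \<open>The spectral moments\<close>

text \<open>
  The fraction under the integral of the heat kernel formula without its exponential factor, in
  partial fractions. Unlike that fraction, it is continuous on the closed interval also for \<open>q = s\<close>.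
\<close>

definition spectral_density :: "real \<Rightarrow> real \<Rightarrow> nat \<Rightarrow> real \<Rightarrow> real" where
  "spectral_density q s n x =
     (pole_integrand (sqrt (q * s)) (int n) x - pole_integrand (- sqrt (s / q)) (int n) x)
       / (sqrt (q * s) + sqrt (s / q))"

definition eigenvalue :: "real \<Rightarrow> real \<Rightarrow> real \<Rightarrow> real" where
  "eigenvalue q s x = (1 + q * s - 2 * sqrt (q * s) * cos x) / (q * (s + 1))"

lemma continuous_on_spectral_density: "continuous_on A (spectral_density q s n)"
  unfolding spectral_density_def divide_inverse[of _ "sqrt (q * s) + sqrt (s / q)"]
  by (intro continuous_on_mult_right continuous_on_diff continuous_on_pole_integrand)

lemma continuous_on_eigenvalue: "continuous_on A (eigenvalue q s)"
  unfolding eigenvalue_def divide_inverse by (intro continuous_intros)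

locale spectral_parameters =
  fixes q s :: real
  assumes q: "q \<ge> 1" and s: "s \<ge> 1"
begin

definition \<rho> where "\<rho> = sqrt (q * s)"
definition \<sigma> where "\<sigma> = sqrt (s / q)"

lemma sqrt_eq_rho_sigma: "sqrt (q * s) = \<rho>" "sqrt (s / q) = \<sigma>"
  by (simp_all add: \<rho>_def \<sigma>_def)

lemma rho_ge_1: "\<rho> \<ge> 1"
  using mult_mono[OF q s] q by (simp add: \<rho>_def)

lemma sigma_pos: "\<sigma> > 0" using q s by (simp add: \<sigma>_def)

lemma rho_sigma: "\<rho> * \<sigma> = s" "\<rho> * \<rho> = q * s" "\<sigma> * \<sigma> = s / q" "\<rho> - \<sigma> = (q - 1) * \<sigma>"
proof -
  show "\<rho> * \<sigma> = s" using q s by (simp add: \<rho>_def \<sigma>_def flip: real_sqrt_mult)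
  show "\<rho> * \<rho> = q * s" "\<sigma> * \<sigma> = s / q" using q s by (simp_all add: \<rho>_def \<sigma>_def)
  have "q * \<sigma> = sqrt (q * q) * \<sigma>" using q by simp
  also have "\<dots> = sqrt (q * q * (s / q))" by (simp only: real_sqrt_mult \<sigma>_def)
  also have "\<dots> = \<rho>" using q by (simp add: \<rho>_def)
  finally show "\<rho> - \<sigma> = (q - 1) * \<sigma>" by (simp add: algebra_simps)
qed

text \<open>
  The denominator of the formula is the squared modulus of \<open>(\<rho> - z) (\<sigma> + z)\<close> for \<open>z = exp (\<i> x)\<close>.
\<close>

lemma spectral_denominator_eq:
  "((q - 1) * \<sigma> + (s - 1) * cos x)\<^sup>2 + ((s + 1) * sin x)\<^sup>2 =
    (\<rho>\<^sup>2 - 2 * \<rho> * cos x + 1) * (\<sigma>\<^sup>2 + 2 * \<sigma> * cos x + 1)"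
proof -
  have "sin x * sin x = 1 - cos x * cos x" using sin_squared_eq[of x] by (simp add: power2_eq_square)
  moreover have "((s + 1) * sin x)\<^sup>2 = (s + 1) * (s + 1) * (sin x * sin x)" by algebra
  ultimately have "((s + 1) * sin x)\<^sup>2 = (s + 1) * (s + 1) * (1 - cos x * cos x)" by (simp only:)
  moreover have "((\<rho> - \<sigma>) + (\<rho> * \<sigma> - 1) * c)\<^sup>2 + (\<rho> * \<sigma> + 1) * (\<rho> * \<sigma> + 1) * (1 - c * c) =
    (\<rho>\<^sup>2 - 2 * \<rho> * c + 1) * (\<sigma>\<^sup>2 + 2 * \<sigma> * c + 1)" for c
    by algebra
  ultimately show ?thesis by (simp only: rho_sigma)
qed

lemma spectral_density_eq:
  assumes x: "sin x \<noteq> 0"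
  shows "spectral_density q s n x =
    (s * sin ((real n + 1) * x) + (q - 1) * \<sigma> * sin (real n * x) - sin ((real n - 1) * x)) * sin x
      / (((q - 1) * \<sigma> + (s - 1) * cos x)\<^sup>2 + ((s + 1) * sin x)\<^sup>2)"
proof -
  define D1 where "D1 = \<rho>\<^sup>2 - 2 * \<rho> * cos x + 1"
  define D2 where "D2 = \<sigma>\<^sup>2 + 2 * \<sigma> * cos x + 1"
  define s0 where "s0 = sin (real n * x)"
  define s1 where "s1 = sin ((real n + 1) * x)"
  have D: "D1 > 0" "D2 > 0"
    using pole_denominator_pos[of \<rho> x] pole_denominator_pos[of "- \<sigma>" x] x by (simp_all add: D1_def D2_def)
  have sum: "\<rho> + \<sigma> > 0" using rho_ge_1 sigma_pos by linarith
  have sm: "sin ((real n - 1) * x) = 2 * cos x * s0 - s1"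
  proof -
    have "(real n - 1) * x = real n * x - x" "(real n + 1) * x = real n * x + x" by (simp_all add: algebra_simps)
    then show ?thesis unfolding s0_def s1_def by (simp only: sin_add sin_diff) (simp add: algebra_simps)
  qed
  \<comment> \<open>The partial fraction identity for the numerators; it uses \<open>\<rho> \<sigma> = s\<close> and
    \<open>\<rho> - \<sigma> = (q - 1) \<sigma>\<close>.\<close>
  have "(\<rho> * s1 - s0) * D2 - (- \<sigma> * s1 - s0) * D1 =
      (\<rho> + \<sigma>) * (\<rho> * \<sigma> * s1 + (\<rho> - \<sigma>) * s0 - (2 * cos x * s0 - s1))"
    unfolding D1_def D2_def by algebra
  then have key: "(\<rho> * s1 - s0) * D2 - (- \<sigma> * s1 - s0) * D1 =
      (\<rho> + \<sigma>) * (s * s1 + (q - 1) * \<sigma> * s0 - sin ((real n - 1) * x))"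
    by (simp only: rho_sigma sm)
  have frac: "S * a / D1 - S * b / D2 = S * (a * D2 - b * D1) / (D1 * D2)" for S a b
    using D by (simp add: field_simps)
  have "spectral_density q s n x =
      (sin x * (\<rho> * s1 - s0) / D1 - sin x * (- \<sigma> * s1 - s0) / D2) / (\<rho> + \<sigma>)"
    unfolding spectral_density_def sqrt_eq_rho_sigma pole_integrand_eq[OF x] D1_def D2_def s0_def s1_def by simp
  also have "\<dots> = sin x * ((\<rho> * s1 - s0) * D2 - (- \<sigma> * s1 - s0) * D1) / (D1 * D2) / (\<rho> + \<sigma>)"
    using frac by (simp only:)
  also have "\<dots> = sin x * (s * s1 + (q - 1) * \<sigma> * s0 - sin ((real n - 1) * x)) / (D1 * D2)"
    unfolding key using sum by simp
  finally show ?thesis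
    unfolding spectral_denominator_eq D1_def[symmetric] D2_def[symmetric] s0_def s1_def
    by (simp add: mult.commute)
qed

lemma sin_nonzero_interior: "x \<in> {0..pi} - {0, pi} \<Longrightarrow> sin x \<noteq> 0"
  using sin_gt_zero[of x] by auto

lemma heat_K_eq:
  "heat_K q s t n = max 0 (q - s) / ((q + 1) * (- q) ^ n) * exp (- t * ((q + 1) / q))
     + 2 * s / (pi * \<rho> ^ n) * integral {0..pi} (\<lambda>x. exp (- t * eigenvalue q s x) * spectral_density q s n x)"
proof -
  have "integral {0..pi} (\<lambda>x.
         exp (- t * ((1 + q * s - 2 * \<rho> * cos x) / (q * (s + 1)))) *
         (s * sin ((real n + 1) * x) + (q - 1) * \<sigma> * sin (real n * x)
            - sin ((real n - 1) * x)) * sin x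
         / (((q - 1) * \<sigma> + (s - 1) * cos x)\<^sup>2 + ((s + 1) * sin x)\<^sup>2)) =
      integral {0..pi} (\<lambda>x. exp (- t * eigenvalue q s x) * spectral_density q s n x)"
  proof (rule integral_spike[of "{0, pi}"])
    fix x assume "x \<in> {0..pi} - {0, pi}"
    from spectral_density_eq[OF sin_nonzero_interior[OF this]]
    show "exp (- t * eigenvalue q s x) * spectral_density q s n x =
         exp (- t * ((1 + q * s - 2 * \<rho> * cos x) / (q * (s + 1)))) *
         (s * sin ((real n + 1) * x) + (q - 1) * \<sigma> * sin (real n * x)
            - sin ((real n - 1) * x)) * sin x
         / (((q - 1) * \<sigma> + (s - 1) * cos x)\<^sup>2 + ((s + 1) * sin x)\<^sup>2)"
      by (simp add: eigenvalue_def sqrt_eq_rho_sigma mult.assoc)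
  qed simp
  then show ?thesis unfolding heat_K_def sqrt_eq_rho_sigma by simp
qed

text \<open>
  Up to factors independent of \<open>n\<close>, the sequence is \<open>u n / \<rho> ^ n\<close> with \<open>u n\<close> a combination of \<open>cos (n x)\<close> and
  \<open>sin (n x)\<close>. For \<open>n > 0\<close> the eigenvalue equation is the addition formula
  \<open>u (n + 1) + u (n - 1) = 2 cos x u n\<close>, valid for every such combination; the equation at \<open>n = 0\<close>
  is the boundary condition that singles out this one, up to scaling.
\<close>

lemma radial_laplacian_spectral_density:
  assumes x: "sin x \<noteq> 0"
  shows "radial_laplacian q s (\<lambda>n. spectral_density q s n x / \<rho> ^ n) n =
    eigenvalue q s x * (spectral_density q s n x / \<rho> ^ n)"
proof -
  define D where "D = ((q - 1) * \<sigma> + (s - 1) * cos x)\<^sup>2 + ((s + 1) * sin x)\<^sup>2"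
  define u where "u n = (s + 1) * sin x * cos (real n * x) + ((s - 1) * cos x + (q - 1) * \<sigma>) * sin (real n * x)" for n
  define F where "F n = u n * (sin x / D) / \<rho> ^ n" for n
  have rho: "\<rho> > 0" using rho_ge_1 by linarith
  have F: "spectral_density q s n x / \<rho> ^ n = F n" for n
  proof -
    have "(real n + 1) * x = real n * x + x" "(real n - 1) * x = real n * x - x" by (simp_all add: algebra_simps)
    then have "s * sin ((real n + 1) * x) + (q - 1) * \<sigma> * sin (real n * x) - sin ((real n - 1) * x) = u n"
      unfolding u_def by (simp only: sin_add sin_diff) (simp add: algebra_simps)
    then show ?thesis unfolding spectral_density_eq[OF x] F_def D_def by simp
  qed
  have qs: "(s + 1) * q > 0" using q s by simp
  have ev: "eigenvalue q s x = 1 - (2 * \<rho> * cos x + q - 1) / ((s + 1) * q)"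
    unfolding eigenvalue_def sqrt_eq_rho_sigma using qs by (simp add: field_simps)
  show ?thesis
  proof (cases n)
    case 0
    have "q * u 1 / \<rho> = (2 * \<rho> * cos x + q - 1) * sin x"
    proof -
      have "q * u 1 = (q * (2 * s * cos x + (q - 1) * \<sigma>)) * sin x"
        unfolding u_def by (simp add: algebra_simps)
      also have "q * (2 * s * cos x + (q - 1) * \<sigma>) = \<rho> * (2 * \<rho> * cos x + q - 1)"
      proof -
        have "\<rho> = q * \<sigma>" using rho_sigma(4) by (simp add: algebra_simps)
        then have "q * ((q - 1) * \<sigma>) = \<rho> * (q - 1)" by simp
        moreover have "\<rho> * (2 * \<rho> * cos x) = 2 * (q * s) * cos x"
        proof -
          have "\<rho> * (2 * \<rho> * cos x) = 2 * (\<rho> * \<rho>) * cos x" by (simp only: ac_simps)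
          then show ?thesis unfolding rho_sigma(2) .
        qed
        ultimately show ?thesis by (simp only: distrib_left right_diff_distrib add_diff_eq)
      qed
      finally show ?thesis using rho by simp
    qed
    then have u1: "u 1 / \<rho> = (2 * \<rho> * cos x + q - 1) * sin x / q"
      using q by (simp add: eq_divide_eq mult.commute)
    have "F 1 = u 1 / \<rho> * (sin x / D)" by (simp add: F_def)
    also have "\<dots> = (2 * \<rho> * cos x + q - 1) / ((s + 1) * q) * F 0"
      unfolding u1 using s by (simp add: F_def u_def)
    finally have "F 1 = (2 * \<rho> * cos x + q - 1) / ((s + 1) * q) * F 0" .
    then show ?thesis unfolding F 0 radial_laplacian_def ev by (simp add: algebra_simps)
  next
    case (Suc k)
    have "u (Suc n) + u k = 2 * cos x * u n"
    proof -
      have "real (Suc n) * x = real n * x + x" "real k * x = real n * x - x" by (simp_all add: Suc algebra_simps)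
      then show ?thesis unfolding u_def by (simp only: sin_add sin_diff cos_add cos_diff) (simp add: algebra_simps)
    qed
    moreover have "s * q * F (Suc n) = \<rho> * u (Suc n) * (sin x / D) / \<rho> ^ n"
    proof -
      have "s * q = \<rho> * \<rho>" using rho_sigma(2) by simp
      then show ?thesis unfolding F_def using rho by simp
    qed
    moreover have "F k = \<rho> * u k * (sin x / D) / \<rho> ^ n" unfolding F_def using rho by (simp add: Suc)
    ultimately have "s * q * F (Suc n) + F k = 2 * \<rho> * cos x * F n"
      unfolding F_def by (simp only: add_divide_distrib[symmetric] distrib_right[symmetric] distrib_left[symmetric] mult.assoc) (simp add: ac_simps)
    then have "s * q * F (n + 1) + (q - 1) * F n + F (n - 1) = (2 * \<rho> * cos x + q - 1) * F n"
      by (simp add: Suc algebra_simps)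
    then show ?thesis unfolding F radial_laplacian_def ev using Suc by (simp add: algebra_simps)
  qed
qed

text \<open>
  The superposition of the radial eigenvectors with their eigenvalues raised to the power \<open>m\<close>: for
  \<open>m = 0\<close> it is the claimed heat kernel at time zero, and summing \<open>(-t) ^ m / m!\<close> times it gives the
  claimed heat kernel at time \<open>t\<close>.
\<close>

definition moment :: "nat \<Rightarrow> nat \<Rightarrow> real" where
  "moment m n = max 0 (q - s) / (q + 1) * ((q + 1) / q) ^ m / (- q) ^ n
     + 2 * s / pi * integral {0..pi} (\<lambda>x. eigenvalue q s x ^ m * (spectral_density q s n x / \<rho> ^ n))"

lemma radial_laplacian_geometric:
  "radial_laplacian q s (\<lambda>n. 1 / (- q) ^ n) n = (q + 1) / q * (1 / (- q) ^ n)"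
proof (cases n)
  case 0
  then show ?thesis using q by (simp add: radial_laplacian_def field_simps)
next
  case (Suc k)
  have q0: "q \<noteq> 0" "s + 1 \<noteq> 0" using q s by auto
  have "(s * q * (1 / (- q) ^ (n + 1)) + (q - 1) * (1 / (- q) ^ n) + 1 / (- q) ^ (n - 1)) =
      (- s + (q - 1) - q) * (1 / (- q) ^ n)"
    using q0 by (simp add: Suc field_simps)
  also have "\<dots> = - (s + 1) * (1 / (- q) ^ n)" by simp
  finally have "(s * q * (1 / (- q) ^ (n + 1)) + (q - 1) * (1 / (- q) ^ n) + 1 / (- q) ^ (n - 1)) / ((s + 1) * q) =
      - 1 / q * (1 / (- q) ^ n)"
    using q0 by (simp only: mult_minus_left minus_divide_left[symmetric] mult_divide_mult_cancel_left_if) (simp add: field_simps)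
  then show ?thesis unfolding radial_laplacian_def using Suc q0 by (simp add: add_divide_distrib distrib_right)
qed

lemma spectral_integrable:
  assumes "continuous_on {0..pi} g"
  shows "(\<lambda>x. g x * (spectral_density q s n x / c)) integrable_on {0..pi}"
  unfolding divide_inverse
  by (intro integrable_continuous_real continuous_intros assms continuous_on_spectral_density)

lemma moment_Suc: "moment (Suc m) n = radial_laplacian q s (moment m) n"
proof -
  let ?f = "\<lambda>m n x. eigenvalue q s x ^ m * (spectral_density q s n x / \<rho> ^ n)"
  let ?d = "max 0 (q - s) / (q + 1) * ((q + 1) / q) ^ m"
  have int: "?f m n integrable_on {0..pi}" for n
    by (intro spectral_integrable continuous_on_power continuous_on_eigenvalue)
  have "radial_laplacian q s (moment m) n =
      radial_laplacian q s (\<lambda>n. ?d * (1 / (- q) ^ n) + 2 * s / pi * integral {0..pi} (?f m n)) n"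
    by (simp add: moment_def[abs_def])
  also have "\<dots> = ?d * ((q + 1) / q * (1 / (- q) ^ n)) +
      2 * s / pi * integral {0..pi} (\<lambda>x. radial_laplacian q s (\<lambda>n. ?f m n x) n)"
    unfolding radial_laplacian_add radial_laplacian_mult radial_laplacian_geometric
      radial_laplacian_integral[OF int] ..
  also have "integral {0..pi} (\<lambda>x. radial_laplacian q s (\<lambda>n. ?f m n x) n) = integral {0..pi} (?f (Suc m) n)"
  proof (rule integral_spike[of "{0, pi}"])
    fix x assume "x \<in> {0..pi} - {0, pi}"
    from radial_laplacian_spectral_density[OF sin_nonzero_interior[OF this]]
    show "?f (Suc m) n x = radial_laplacian q s (\<lambda>n. ?f m n x) n"
      unfolding radial_laplacian_mult by simp
  qed simp
  also have "?d * ((q + 1) / q * (1 / (- q) ^ n)) + 2 * s / pi * integral {0..pi} (?f (Suc m) n) = moment (Suc m) n"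
    by (simp add: moment_def ac_simps)
  finally show ?thesis by (rule sym)
qed

lemma integral_spectral_density:
  "integral {0..pi} (spectral_density q s n) =
    (integral {0..pi} (pole_integrand \<rho> (int n)) - integral {0..pi} (pole_integrand (- \<sigma>) (int n))) / (\<rho> + \<sigma>)"
  unfolding spectral_density_def[abs_def] sqrt_eq_rho_sigma
  by (intro integral_unique has_integral_divide has_integral_diff integrable_integral pole_integrand_integrable)

text \<open>
  The initial condition. When \<open>q > s\<close> the pole \<open>-\<sigma>\<close> lies inside the unit circle and contributes
  \<open>- (q - s) / ((q + 1) (-q) ^ n)\<close> for \<open>n > 0\<close>, which the discrete term cancels because
  \<open>\<sigma> / \<rho> = 1 / q\<close>.
\<close>

lemma moment_0: "moment 0 n = of_bool (n = 0)"
proof -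
  have sum: "\<rho> + \<sigma> > 0" "\<rho> > 0" using rho_ge_1 sigma_pos by linarith+
  have q0: "q > 0" "s > 0" using q s by auto
  have "integral {0..pi} (\<lambda>x. spectral_density q s n x / \<rho> ^ n) =
      integral {0..pi} (spectral_density q s n) / \<rho> ^ n"
    by (rule integral_divide)
  then have M: "moment 0 n = max 0 (q - s) / (q + 1) / (- q) ^ n
      + 2 * s / pi * ((integral {0..pi} (pole_integrand \<rho> (int n)) - integral {0..pi} (pole_integrand (- \<sigma>) (int n))) / (\<rho> + \<sigma>) / \<rho> ^ n)"
    by (simp add: moment_def integral_spectral_density)
  have out: "integral {0..pi} (pole_integrand \<rho> (int n)) = (if n = 0 then pi / (2 * \<rho>) else 0)"
    by (rule integral_pole_integrand_outside) (use rho_ge_1 in simp)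
  have rq: "\<rho> = q * \<sigma>" using rho_sigma(4) by (simp add: algebra_simps)
  have ss: "\<sigma>\<^sup>2 = s / q" using rho_sigma(3) by (simp add: power2_eq_square)
  show ?thesis
  proof (cases "s \<ge> q")
    case True
    then have "\<sigma> \<ge> 1" using q0 by (simp add: \<sigma>_def)
    then have "integral {0..pi} (pole_integrand (- \<sigma>) (int n)) = (if n = 0 then pi / (2 * - \<sigma>) else 0)"
      by (intro integral_pole_integrand_outside) simp
    moreover have "2 * s / pi * ((pi / (2 * \<rho>) - pi / (2 * - \<sigma>)) / (\<rho> + \<sigma>)) = 1"
    proof -
      have "pi / (2 * \<rho>) - pi / (2 * - \<sigma>) = pi * (\<rho> + \<sigma>) / (2 * (\<rho> * \<sigma>))"
        using sum sigma_pos by (simp add: field_simps)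
      then show ?thesis unfolding rho_sigma(1) using sum q0 by simp
    qed
    ultimately show ?thesis unfolding M out using True by auto
  next
    case False
    then have s1: "\<sigma> < 1" using q0 by (simp add: \<sigma>_def)
    then have c: "\<bar>- \<sigma>\<bar> < 1" using sigma_pos by simp
    note ins = integral_pole_integrand_inside[OF c]
    have dif: "max 0 (q - s) = q - s" using False by simp
    show ?thesis
    proof (cases n)
      case 0
      have "2 * s / pi * ((pi / (2 * \<rho>) - (- \<sigma> * pi / 2)) / (\<rho> + \<sigma>)) = (1 + s) / (q + 1)"
      proof -
        have "pi / (2 * \<rho>) - (- \<sigma> * pi / 2) = pi * (1 + \<rho> * \<sigma>) / (2 * \<rho>)"
          using sum by (simp add: field_simps)
        then have "2 * s / pi * ((pi / (2 * \<rho>) - (- \<sigma> * pi / 2)) / (\<rho> + \<sigma>)) = s * (1 + s) / (\<rho> * (\<rho> + \<sigma>))"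
          unfolding rho_sigma(1) using sum by simp
        also have "\<rho> * (\<rho> + \<sigma>) = s * (q + 1)"
          unfolding distrib_left rho_sigma by (simp add: algebra_simps)
        finally show ?thesis using q0 by simp
      qed
      moreover have "(q - s) / (q + 1) + (1 + s) / (q + 1) = 1" using q0 by (simp flip: add_divide_distrib)
      ultimately show ?thesis unfolding M out using 0 ins(1) dif by simp
    next
      case (Suc k)
      have "2 * s / pi * ((0 - (- (1 - (- \<sigma>)\<^sup>2) * pi / 2 * (- \<sigma>) ^ k)) / (\<rho> + \<sigma>) / \<rho> ^ n) =
          s * (1 - \<sigma>\<^sup>2) / (\<rho> * (\<rho> + \<sigma>)) * ((- \<sigma>) ^ k / \<rho> ^ k)"
      proof -
        have "2 * s / pi * ((0 - (- (1 - a) * pi / 2 * e)) / w / (\<rho> * p)) = s * (1 - a) / (\<rho> * w) * (e / p)"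
          if "w \<noteq> 0" "p \<noteq> 0" for a e w p
          using that sum(2) by (simp add: field_simps)
        from this[of "\<rho> + \<sigma>" "\<rho> ^ k" "\<sigma>\<^sup>2" "(- \<sigma>) ^ k"] show ?thesis unfolding Suc using sum by simp
      qed
      also have "\<rho> * (\<rho> + \<sigma>) = s * (q + 1)"
        unfolding distrib_left rho_sigma by (simp add: algebra_simps)
      also have "(- \<sigma>) ^ k / \<rho> ^ k = 1 / (- q) ^ k"
      proof -
        have "- \<sigma> / \<rho> = 1 / - q" unfolding rq using sigma_pos q0 by simp
        then show ?thesis by (metis power_divide power_one)
      qed
      also have "s * (1 - \<sigma>\<^sup>2) / (s * (q + 1)) = (q - s) / (q * (q + 1))"
      proof -
        have "1 - s / q = (q - s) / q" using q0 by (simp add: diff_divide_distrib)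
        then show ?thesis unfolding ss using q0 by simp
      qed
      finally have res: "2 * s / pi * ((0 - (- (1 - (- \<sigma>)\<^sup>2) * pi / 2 * (- \<sigma>) ^ k)) / (\<rho> + \<sigma>) / \<rho> ^ n) =
          - ((q - s) / (q + 1) / (- q) ^ n)"
        unfolding Suc using q0 by (simp add: field_simps)
      have ins': "integral {0..pi} (pole_integrand (- \<sigma>) (int n)) = - (1 - (- \<sigma>)\<^sup>2) * pi / 2 * (- \<sigma>) ^ k"
        unfolding Suc by (rule ins(2))
      have "moment 0 n = (q - s) / (q + 1) / (- q) ^ n
          + 2 * s / pi * ((0 - (- (1 - (- \<sigma>)\<^sup>2) * pi / 2 * (- \<sigma>) ^ k)) / (\<rho> + \<sigma>) / \<rho> ^ n)"
        unfolding M out ins' dif using Suc by simp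
      also have "\<dots> = of_bool (n = 0)" unfolding res using Suc by simp
      finally show ?thesis .
    qed
  qed
qed

lemma funpow_radial_laplacian: "(radial_laplacian q s ^^ m) (\<lambda>n. of_bool (n = 0)) = moment m"
proof (induction m)
  case 0
  show ?case by (rule ext) (simp add: moment_0)
next
  case (Suc m)
  show ?case by (rule ext) (simp add: Suc moment_Suc)
qed

text \<open>
  Integral and exponential series are interchanged by dominated convergence, with the exponential
  of the absolute value as the majorant of the partial sums.
\<close>

lemma exp_moments_sums: "(\<lambda>m. (- t) ^ m * moment m n / fact m) sums heat_K q s t n"
proof -
  let ?w = "\<lambda>x. spectral_density q s n x / \<rho> ^ n" and ?\<mu> = "eigenvalue q s"
  let ?f = "\<lambda>M x. (\<Sum>m<M. (- t * ?\<mu> x) ^ m / fact m) * ?w x"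
  note cont = continuous_on_eigenvalue continuous_on_spectral_density
  have fin: "?f M integrable_on {0..pi}" for M
    by (intro spectral_integrable continuous_intros cont) auto
  have "(\<lambda>M. integral {0..pi} (?f M)) \<longlonglongrightarrow> integral {0..pi} (\<lambda>x. exp (- t * ?\<mu> x) * ?w x)"
  proof (rule dominated_convergence(2)[OF fin])
    show "(\<lambda>x. exp \<bar>t * ?\<mu> x\<bar> * \<bar>?w x\<bar>) integrable_on {0..pi}"
      unfolding divide_inverse by (intro integrable_continuous_real continuous_intros cont)
    show "norm (?f M x) \<le> exp \<bar>t * ?\<mu> x\<bar> * \<bar>?w x\<bar>" for M x
    proof -
      have "\<bar>\<Sum>m<M. (- t * ?\<mu> x) ^ m / fact m\<bar> \<le> (\<Sum>m<M. \<bar>t * ?\<mu> x\<bar> ^ m / fact m)"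
        by (rule order_trans[OF sum_abs]) (auto simp: abs_mult power_abs)
      also have "\<dots> \<le> exp \<bar>t * ?\<mu> x\<bar>"
        using sum_le_suminf[OF sums_summable[OF exp_series_real_sums], of "{..<M}" "\<bar>t * ?\<mu> x\<bar>"]
          exp_series_real_sums[of "\<bar>t * ?\<mu> x\<bar>"] by (simp add: sums_iff)
      finally show ?thesis unfolding real_norm_def abs_mult by (intro mult_right_mono) auto
    qed
    show "(\<lambda>M. ?f M x) \<longlonglongrightarrow> exp (- t * ?\<mu> x) * ?w x" for x
      using exp_series_real_sums[of "- t * ?\<mu> x"] unfolding sums_def by (intro tendsto_intros)
  qed
  moreover have "integral {0..pi} (?f M) = (\<Sum>m<M. (- t) ^ m / fact m * integral {0..pi} (\<lambda>x. ?\<mu> x ^ m * ?w x))" for M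
  proof -
    have "?f M = (\<lambda>x. \<Sum>m<M. (- t) ^ m / fact m * (?\<mu> x ^ m * ?w x))"
      by (simp only: fun_eq_iff sum_distrib_right power_mult_distrib) (simp add: ac_simps)
    moreover have "((\<lambda>x. \<Sum>m<M. (- t) ^ m / fact m * (?\<mu> x ^ m * ?w x)) has_integral
        (\<Sum>m<M. (- t) ^ m / fact m * integral {0..pi} (\<lambda>x. ?\<mu> x ^ m * ?w x))) {0..pi}"
      by (intro has_integral_sum has_integral_mult_right integrable_integral spectral_integrable
          continuous_on_power cont) auto
    ultimately show ?thesis by (simp only: integral_unique)
  qed
  ultimately have "(\<lambda>m. (- t) ^ m / fact m * integral {0..pi} (\<lambda>x. ?\<mu> x ^ m * ?w x)) sums
      integral {0..pi} (\<lambda>x. exp (- t * ?\<mu> x) * ?w x)"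
    unfolding sums_def by (simp only:)
  then have "(\<lambda>m. max 0 (q - s) / ((q + 1) * (- q) ^ n) * ((- t * ((q + 1) / q)) ^ m / fact m) +
      2 * s / pi * ((- t) ^ m / fact m * integral {0..pi} (\<lambda>x. ?\<mu> x ^ m * ?w x))) sums
      (max 0 (q - s) / ((q + 1) * (- q) ^ n) * exp (- t * ((q + 1) / q)) +
       2 * s / pi * integral {0..pi} (\<lambda>x. exp (- t * ?\<mu> x) * ?w x))"
    by (intro sums_add sums_mult exp_series_real_sums)
  moreover have "max 0 (q - s) / ((q + 1) * (- q) ^ n) * ((- t * ((q + 1) / q)) ^ m / fact m) +
      2 * s / pi * ((- t) ^ m / fact m * integral {0..pi} (\<lambda>x. ?\<mu> x ^ m * ?w x)) =
      (- t) ^ m * moment m n / fact m" for m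
    unfolding moment_def power_mult_distrib
    by (simp only: distrib_left add_divide_distrib) (simp add: ac_simps)
  moreover have "2 * s / pi * integral {0..pi} (\<lambda>x. exp (- t * ?\<mu> x) * ?w x) =
      2 * s / (pi * \<rho> ^ n) * integral {0..pi} (\<lambda>x. exp (- t * ?\<mu> x) * spectral_density q s n x)"
  proof -
    have "integral {0..pi} (\<lambda>x. exp (- t * ?\<mu> x) * ?w x) =
        integral {0..pi} (\<lambda>x. exp (- t * ?\<mu> x) * spectral_density q s n x / \<rho> ^ n)"
      by simp
    also have "\<dots> = integral {0..pi} (\<lambda>x. exp (- t * ?\<mu> x) * spectral_density q s n x) / \<rho> ^ n"
      by (rule integral_divide)
    finally show ?thesis by simp
  qed
  ultimately show ?thesis unfolding heat_K_eq by (simp only:)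
qed

end

theorem theorem1p1:
  fixes G :: "nat \<Rightarrow> 'a monoid" and r L :: nat
    and k :: "real \<Rightarrow> (nat \<times> 'a) list \<Rightarrow> real"
  assumes "r \<ge> 2" and "L \<ge> 2"
    and "\<And>i. i \<in> {1..r} \<Longrightarrow> group (G i)"
    and "\<And>i. i \<in> {1..r} \<Longrightarrow> finite (carrier (G i))"
    and "\<And>i. i \<in> {1..r} \<Longrightarrow> card (carrier (G i)) = L"
  shows "is_heat_kernel (free_product {1..r} G) (factor_generators {1..r} G) k \<longleftrightarrow>
    (\<forall>t\<ge>0. \<forall>g\<in>carrier (free_product {1..r} G).
       k t g = heat_K (real L - 1) (real r - 1) t (length g))"
proof -
  interpret finite_factors "{1..r}" G L
    by (rule finite_factors.intro) (use assms in auto)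
  interpret spectral_parameters "real L - 1" "real r - 1"
    by unfold_locales (use assms(1,2) in auto)
  let ?A = "free_product {1..r} G" and ?S = "factor_generators {1..r} G"
  interpret A: group ?A by (rule free_product_group[OF factor_group])
  have sums: "(\<lambda>m. ((\<lambda>f x. - of_real t * cayley_laplacian ?A ?S f x) ^^ m) (point_mass \<one>\<^bsub>?A\<^esub>) x / fact m)
      sums of_real (heat_K (real L - 1) (real r - 1) t (length x))"
    if "x \<in> carrier ?A" for t x
  proof -
    have "((\<lambda>f x. - of_real t * cayley_laplacian ?A ?S f x) ^^ m) (point_mass \<one>\<^bsub>?A\<^esub>) x / fact m =
        of_real ((- t) ^ m * moment m (length x) / fact m)" for m
      using cayley_laplacian_funpow_radial[OF that, where c = "- t" and m = m] by (simp add: funpow_radial_laplacian)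
    then show ?thesis using sums_of_real[OF exp_moments_sums] by (simp only:)
  qed
  have "((\<lambda>m. ((\<lambda>f x. - of_real t * cayley_laplacian ?A ?S f x) ^^ m) (point_mass \<one>\<^bsub>?A\<^esub>) x / fact m)
      sums of_real (k t x)) \<longleftrightarrow> k t x = heat_K (real L - 1) (real r - 1) t (length x)"
    if "x \<in> carrier ?A" for t x
    using sums[OF that, of t] sums_unique2 by fastforce
  then show ?thesis
    unfolding A.is_heat_kernel_iff[OF finite_factor_generators factor_generators_carrier] by blast
qed

end
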